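(* Let $(H,R)$ be a semiquasitriangular Hopf algebra and $M$ a finite dimensional normal $(H,R)$-module. Let $\{m_i,m_i^*\}_{i\in I}$ be dual bases of $M$ and $M^*=\operatorname{Hom}_k(M,k)$. Define on $M^*$ the left action $(h\cdot f)(m)=f(S(h)\cdot m)$ and the map $\nu_{M^*}:M^*\to M^*\otimes H$, $\nu_{M^*}(f)=\sum_{i\in I} f((m_i)_0)\,m_i^*\otimes S^{-1}((m_i)_1)$ (equivalently, $f_0(m)f_1=f(m_0)S^{-1}(m_1)$ for $m\in M$). Then $M^*$ with this action and coaction is a normal $(H,R)$-module.
   Context: All vector spaces are over a field $k$, $\otimes=\otimes_k$. For a Hopf algebra $H$ with comultiplication $\Delta$, counit $\epsilon$, antipode $S$, we use Sweedler notation $\Delta(h)=h_1\otimes h_2$, etc. $\operatorname{Z}(H)$ is the centre of $H$. For $R\in H\otimes H$ we write $R=R^{(1)}\otimes R^{(2)}$ (summation understood); $R'^{(1)}\otimes R'^{(2)}$ denotes another copy of $R$. Definition (semiquasitriangular Hopf algebra): a pair $(H,R)$ with $H$ a Hopf algebra with bijective antipode and $R\in H\otimes H$ invertible such that (1) $R^{(1)}_1\otimes R^{(1)}_2\otimes R^{(2)} = R^{(1)}\otimes R'^{(1)}\otimes R^{(2)}R'^{(2)}$; (2) $R^{(1)}\otimes R^{(2)}_1\otimes R^{(2)}_2 = R^{(1)}R'^{(1)}\otimes R'^{(2)}\otimes R^{(2)}$; (3) $R^{(1)}\otimes R^{(2)}_2R'^{(1)}\otimes R^{(2)}_1R'^{(2)}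 = R^{(1)}\otimes R'^{(1)}R^{(2)}_1\otimes R'^{(2)}R^{(2)}_2$; (4) $R^{(1)}_2R'^{(1)}\otimes R^{(1)}_1R'^{(2)}\otimes R^{(2)} = R'^{(1)}R^{(1)}_1\otimes R'^{(2)}R^{(1)}_2\otimes R^{(2)}$; (5) $\nu(h):=R^{(2)}h_2R'^{(2)}\otimes S(h_1)S(R^{(1)})h_3R'^{(1)}\in H\otimes\operatorname{Z}(H)$ for all $h\in H$; (6) $\nu(h)=R^{(1)}h_2R'^{(1)}\otimes S(R'^{(2)})S(h_1)R^{(2)}h_3$ for all $h\in H$. Definition (normal $(H,R)$-module): a vector space $M$ with a left $H$-module action $h\otimes m\mapsto h\cdot m$ and a right $H$-comodule coaction $\nu_M(m)=m_0\otimes m_1$ such that for all $h\in H$, $m\in M$: (i) $\nu_M(m)\in M\otimes\operatorname{Z}(H)$; (ii) $\nu_M(h\cdot m)=R^{(2)}h_2R'^{(2)}\cdot m_0\otimes S(h_1)S(R^{(1)})h_3R'^{(1)}m_1$. *)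

theory Defs
  imports Complex_Main "HOL-Library.Function_Algebras"
begin

(* Tensors over a field 'k are represented by finite lists of pure tensors (finite sums).
   Two such lists denote the same element of V \<otimes> W iff they agree on all products of
   linear functionals (over a field, V tensor W embeds into the dual of V-dual tensor W-dual). *)

definition ten2_eq ::
  "('k::field \<Rightarrow> 'a::ab_group_add \<Rightarrow> 'a) \<Rightarrow> ('k \<Rightarrow> 'b::ab_group_add \<Rightarrow> 'b)
   \<Rightarrow> ('a \<times> 'b) list \<Rightarrow> ('a \<times> 'b) list \<Rightarrow> bool" where
  "ten2_eq sa sb xs ys \<longleftrightarrow>
     (\<forall>f g. Vector_Spaces.linear sa (*) f \<longrightarrow> Vector_Spaces.linear sb (*) g \<longrightarrow>
        sum_list (map (\<lambda>(a,b). f a * g b) xs) = sum_list (map (\<lambda>(a,b). f a * g b) ys))"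

definition ten3_eq ::
  "('k::field \<Rightarrow> 'a::ab_group_add \<Rightarrow> 'a) \<Rightarrow> ('k \<Rightarrow> 'b::ab_group_add \<Rightarrow> 'b)
   \<Rightarrow> ('k \<Rightarrow> 'c::ab_group_add \<Rightarrow> 'c)
   \<Rightarrow> ('a \<times> 'b \<times> 'c) list \<Rightarrow> ('a \<times> 'b \<times> 'c) list \<Rightarrow> bool" where
  "ten3_eq sa sb sc xs ys \<longleftrightarrow>
     (\<forall>f g h. Vector_Spaces.linear sa (*) f \<longrightarrow> Vector_Spaces.linear sb (*) g
        \<longrightarrow> Vector_Spaces.linear sc (*) h \<longrightarrow>
        sum_list (map (\<lambda>(a,b,c). f a * g b * h c) xs) = sum_list (map (\<lambda>(a,b,c). f a * g b * h c) ys))"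

definition center :: "'h::ring_1 set" where
  "center = {z. \<forall>x. z * x = x * z}"

definition tmult :: "('h::ring_1 \<times> 'h) list \<Rightarrow> ('h \<times> 'h) list \<Rightarrow> ('h \<times> 'h) list" where
  "tmult xs ys = concat (map (\<lambda>(a,b). map (\<lambda>(c,d). (a*c, b*d)) ys) xs)"

definition Delta2 :: "('h \<Rightarrow> ('h \<times> 'h) list) \<Rightarrow> 'h \<Rightarrow> ('h \<times> 'h \<times> 'h) list" where
  "Delta2 Delta h = concat (map (\<lambda>(x,y). map (\<lambda>(x1,x2). (x1,x2,y)) (Delta x)) (Delta h))"

definition hopf_algebra ::
  "('k::field \<Rightarrow> 'h::ring_1 \<Rightarrow> 'h) \<Rightarrow> ('h \<Rightarrow> ('h \<times> 'h) list) \<Rightarrow> ('h \<Rightarrow> 'k) \<Rightarrow> ('h \<Rightarrow> 'h) \<Rightarrow> bool" where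
  "hopf_algebra sH Delta eps S \<longleftrightarrow>
     Vector_Spaces.vector_space sH \<and>
     \<comment> \<open>algebra\<close>
     (\<forall>c x y. sH c (x * y) = sH c x * y \<and> sH c (x * y) = x * sH c y) \<and>
     \<comment> \<open>coalgebra\<close>
     (\<forall>x y. ten2_eq sH sH (Delta (x + y)) (Delta x @ Delta y)) \<and>
     (\<forall>c x. ten2_eq sH sH (Delta (sH c x)) (map (\<lambda>(a,b). (sH c a, b)) (Delta x))) \<and>
     Vector_Spaces.linear sH (*) eps \<and>
     (\<forall>h. ten3_eq sH sH sH (Delta2 Delta h)
            (concat (map (\<lambda>(a,b). map (\<lambda>(b1,b2). (a,b1,b2)) (Delta b)) (Delta h)))) \<and>
     (\<forall>h. sum_list (map (\<lambda>(a,b). sH (eps a) b) (Delta h)) = h) \<and>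
     (\<forall>h. sum_list (map (\<lambda>(a,b). sH (eps b) a) (Delta h)) = h) \<and>
     \<comment> \<open>bialgebra\<close>
     (\<forall>x y. ten2_eq sH sH (Delta (x * y)) (tmult (Delta x) (Delta y))) \<and>
     ten2_eq sH sH (Delta 1) [(1,1)] \<and>
     (\<forall>x y. eps (x * y) = eps x * eps y) \<and> eps 1 = 1 \<and>
     \<comment> \<open>antipode\<close>
     Vector_Spaces.linear sH sH S \<and>
     (\<forall>h. sum_list (map (\<lambda>(a,b). S a * b) (Delta h)) = sH (eps h) 1) \<and>
     (\<forall>h. sum_list (map (\<lambda>(a,b). a * S b) (Delta h)) = sH (eps h) 1)"

definition nuH :: "('h::ring_1 \<Rightarrow> ('h \<times> 'h) list) \<Rightarrow> ('h \<Rightarrow> 'h) \<Rightarrow> ('h \<times> 'h) list \<Rightarrow> 'h \<Rightarrow> ('h \<times> 'h) list" where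
  "nuH Delta S R h = concat (map (\<lambda>(h1,h2,h3). concat (map (\<lambda>(a,b). map (\<lambda>(a',b').
       (b * h2 * b', S h1 * S a * h3 * a')) R) R)) (Delta2 Delta h))"

definition semiquasitriangular ::
  "('k::field \<Rightarrow> 'h::ring_1 \<Rightarrow> 'h) \<Rightarrow> ('h \<Rightarrow> ('h \<times> 'h) list) \<Rightarrow> ('h \<Rightarrow> 'k) \<Rightarrow> ('h \<Rightarrow> 'h)
   \<Rightarrow> ('h \<times> 'h) list \<Rightarrow> bool" where
  "semiquasitriangular sH Delta eps S R \<longleftrightarrow>
     hopf_algebra sH Delta eps S \<and> bij S \<and>
     (\<exists>Ri. ten2_eq sH sH (tmult R Ri) [(1,1)] \<and> ten2_eq sH sH (tmult Ri R) [(1,1)]) \<and>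
     \<comment> \<open>(1)\<close>
     ten3_eq sH sH sH
       (concat (map (\<lambda>(a,b). map (\<lambda>(a1,a2). (a1,a2,b)) (Delta a)) R))
       (concat (map (\<lambda>(a,b). map (\<lambda>(a',b'). (a,a',b*b')) R) R)) \<and>
     \<comment> \<open>(2)\<close>
     ten3_eq sH sH sH
       (concat (map (\<lambda>(a,b). map (\<lambda>(b1,b2). (a,b1,b2)) (Delta b)) R))
       (concat (map (\<lambda>(a,b). map (\<lambda>(a',b'). (a*a',b',b)) R) R)) \<and>
     \<comment> \<open>(3)\<close>
     ten3_eq sH sH sH
       (concat (map (\<lambda>(a,b). concat (map (\<lambda>(b1,b2). map (\<lambda>(a',b'). (a, b2*a', b1*b')) R) (Delta b))) R))
       (concat (map (\<lambda>(a,b). concat (map (\<lambda>(b1,b2). map (\<lambda>(a',b'). (a, a'*b1, b'*b2)) R) (Delta b))) R)) \<and>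
     \<comment> \<open>(4)\<close>
     ten3_eq sH sH sH
       (concat (map (\<lambda>(a,b). concat (map (\<lambda>(a1,a2). map (\<lambda>(a',b'). (a2*a', a1*b', b)) R) (Delta a))) R))
       (concat (map (\<lambda>(a,b). concat (map (\<lambda>(a1,a2). map (\<lambda>(a',b'). (a'*a1, b'*a2, b)) R) (Delta a))) R)) \<and>
     \<comment> \<open>(5)\<close>
     (\<forall>h. \<exists>ys. ten2_eq sH sH (nuH Delta S R h) ys \<and> (\<forall>p\<in>set ys. snd p \<in> center)) \<and>
     \<comment> \<open>(6)\<close>
     (\<forall>h. ten2_eq sH sH (nuH Delta S R h)
        (concat (map (\<lambda>(h1,h2,h3). concat (map (\<lambda>(a,b). map (\<lambda>(a',b').
           (a * h2 * a', S b' * S h1 * b * h3)) R) R)) (Delta2 Delta h))))"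

definition normal_module ::
  "('k::field \<Rightarrow> 'h::ring_1 \<Rightarrow> 'h) \<Rightarrow> ('h \<Rightarrow> ('h \<times> 'h) list) \<Rightarrow> ('h \<Rightarrow> 'k) \<Rightarrow> ('h \<Rightarrow> 'h)
   \<Rightarrow> ('h \<times> 'h) list
   \<Rightarrow> ('k \<Rightarrow> 'm::ab_group_add \<Rightarrow> 'm) \<Rightarrow> 'm set \<Rightarrow> ('h \<Rightarrow> 'm \<Rightarrow> 'm) \<Rightarrow> ('m \<Rightarrow> ('m \<times> 'h) list) \<Rightarrow> bool" where
  "normal_module sH Delta eps S R sM Mc act coact \<longleftrightarrow>
     Vector_Spaces.vector_space sM \<and> module.subspace sM Mc \<and>
     \<comment> \<open>left H-module\<close>
     (\<forall>h m. m \<in> Mc \<longrightarrow> act h m \<in> Mc) \<and>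
     (\<forall>h g m. m \<in> Mc \<longrightarrow> act (h + g) m = act h m + act g m) \<and>
     (\<forall>c h m. m \<in> Mc \<longrightarrow> act (sH c h) m = sM c (act h m)) \<and>
     (\<forall>h m n. m \<in> Mc \<longrightarrow> n \<in> Mc \<longrightarrow> act h (m + n) = act h m + act h n) \<and>
     (\<forall>c h m. m \<in> Mc \<longrightarrow> act h (sM c m) = sM c (act h m)) \<and>
     (\<forall>h g m. m \<in> Mc \<longrightarrow> act (h * g) m = act h (act g m)) \<and>
     (\<forall>m. m \<in> Mc \<longrightarrow> act 1 m = m) \<and>
     \<comment> \<open>right H-comodule\<close>
     (\<forall>m. m \<in> Mc \<longrightarrow> fst ` set (coact m) \<subseteq> Mc) \<and>
     (\<forall>m n. m \<in> Mc \<longrightarrow> n \<in> Mc \<longrightarrow> ten2_eq sM sH (coact (m + n)) (coact m @ coact n)) \<and>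
     (\<forall>c m. m \<in> Mc \<longrightarrow> ten2_eq sM sH (coact (sM c m)) (map (\<lambda>(a,b). (sM c a, b)) (coact m))) \<and>
     (\<forall>m. m \<in> Mc \<longrightarrow> ten3_eq sM sH sH
        (concat (map (\<lambda>(m0,m1). map (\<lambda>(m00,m01). (m00,m01,m1)) (coact m0)) (coact m)))
        (concat (map (\<lambda>(m0,m1). map (\<lambda>(c,d). (m0,c,d)) (Delta m1)) (coact m)))) \<and>
     (\<forall>m. m \<in> Mc \<longrightarrow> sum_list (map (\<lambda>(m0,m1). sM (eps m1) m0) (coact m)) = m) \<and>
     \<comment> \<open>(i)\<close>
     (\<forall>m. m \<in> Mc \<longrightarrow> (\<exists>ys. ten2_eq sM sH (coact m) ys \<and> (\<forall>p\<in>set ys. fst p \<in> Mc \<and> snd p \<in> center))) \<and>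
     \<comment> \<open>(ii)\<close>
     (\<forall>h m. m \<in> Mc \<longrightarrow> ten2_eq sM sH (coact (act h m))
        (concat (map (\<lambda>(h1,h2,h3). concat (map (\<lambda>(a,b). concat (map (\<lambda>(a',b').
            map (\<lambda>(m0,m1). (act (b * h2 * b') m0, S h1 * S a * h3 * a' * m1)) (coact m)) R)) R))
          (Delta2 Delta h))))"

definition dual_scale :: "'k::field \<Rightarrow> ('m \<Rightarrow> 'k) \<Rightarrow> ('m \<Rightarrow> 'k)" where
  "dual_scale c f = (\<lambda>x. c * f x)"

definition dual_space :: "('k::field \<Rightarrow> 'm::ab_group_add \<Rightarrow> 'm) \<Rightarrow> ('m \<Rightarrow> 'k) set" where
  "dual_space sM = {f. Vector_Spaces.linear sM (*) f}"

definition dual_act :: "('h \<Rightarrow> 'h) \<Rightarrow> ('h \<Rightarrow> 'm \<Rightarrow> 'm) \<Rightarrow> 'h \<Rightarrow> ('m \<Rightarrow> 'k) \<Rightarrow> ('m \<Rightarrow> 'k)" where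
  "dual_act S act h f = (\<lambda>m. f (act (S h) m))"

definition dual_coact ::
  "('h \<Rightarrow> 'h) \<Rightarrow> ('m \<Rightarrow> ('m \<times> 'h) list) \<Rightarrow> ('m \<times> ('m \<Rightarrow> 'k::field)) list
   \<Rightarrow> ('m \<Rightarrow> 'k) \<Rightarrow> (('m \<Rightarrow> 'k) \<times> 'h) list" where
  "dual_coact S coact B f =
     concat (map (\<lambda>(mi, fi). map (\<lambda>(a,b). (dual_scale (f a) fi, inv S b)) (coact mi)) B)"

definition dual_bases :: "('k::field \<Rightarrow> 'm::ab_group_add \<Rightarrow> 'm) \<Rightarrow> 'm set \<Rightarrow> ('m \<times> ('m \<Rightarrow> 'k)) list \<Rightarrow> bool" where
  "dual_bases sM Mc B \<longleftrightarrow>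
     (\<forall>i<length B. fst (B ! i) \<in> Mc \<and> Vector_Spaces.linear sM (*) (snd (B ! i))) \<and>
     (\<forall>i<length B. \<forall>j<length B. snd (B ! i) (fst (B ! j)) = (if i = j then 1 else 0)) \<and>
     (\<forall>m\<in>Mc. m = sum_list (map (\<lambda>(mi,fi). sM (fi m) mi) B))"

end

theory Submission
  imports Defs
begin

text \<open>
  Write \<open>\<nu> h = h\<^sub>(\<^sub>0\<^sub>) \<otimes> h\<^sub>(\<^sub>1\<^sub>)\<close> for the map of axiom (5), so that \<open>h\<^sub>2\<^sub>(\<^sub>0\<^sub>) \<otimes> h\<^sub>1 h\<^sub>2\<^sub>(\<^sub>1\<^sub>)\<close>
  is \<open>\<Delta> h\<close> conjugated by \<open>R\<^sup>(\<^sup>2\<^sup>) \<otimes> R\<^sup>(\<^sup>1\<^sup>)\<close>. As the second leg of \<open>\<nu>\<close> is central, this makes \<open>\<nu>\<close>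
  multiplicative and compatible with \<open>\<Delta>\<close>, hence \<open>\<nu> \<circ> S = (S \<otimes> id) \<circ> \<nu>\<close> by uniqueness of convolution
  inverses; axioms (1)-(3) make \<open>\<nu>\<close> a coaction. Consequently
  \<open>(S h\<^sub>(\<^sub>0\<^sub>))\<^sub>(\<^sub>0\<^sub>) \<otimes> h\<^sub>(\<^sub>1\<^sub>) S\<^sup>-\<^sup>1((S h\<^sub>(\<^sub>0\<^sub>))\<^sub>(\<^sub>1\<^sub>)) = S h \<otimes> 1\<close>, which is what condition (ii) for the dual
  amounts to once functionals on the dual are identified with vectors.
\<close>

section \<open>Multilinear forms and tensors\<close>

text \<open>The lists returned by \<open>Delta\<close> and \<open>coact\<close> represent tensors
  only up to \<open>ten2_eq\<close>; nothing makes them additive or coassociative as lists. A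
  Sweedler identity can therefore be applied only under a multilinear form, and multilinearity of
  the remaining expression is a side condition of nearly every step.

  The cancellation identity that closes the overview comes from testing condition (ii) for the dual
  on evaluation at a vector \<open>n\<close>. There \<open>x\<close> acting on a functional becomes
  \<open>S x\<close> acting on \<open>n\<close>, so condition (ii) for the original module
  contributes \<open>nu (S x)\<close>, with \<open>x\<close> the first leg of \<open>nu h\<close>,
  and the dual coaction puts \<open>Sinv\<close> on its second leg.

  Multiplicativity of \<open>nu\<close> serves twice. It lets \<open>nu\<close> take part in a
  convolution argument for \<open>S\<close>, and it reduces \<open>nu (b * h2 * b')\<close>, which
  coassociativity has to compute, to \<open>nu h2\<close>, because the second legs of
  \<open>R\<close> are coinvariant. Coinvariance is where axiom (3) enters.\<close>

definition lform :: "('k::field \<Rightarrow> 'a::ab_group_add \<Rightarrow> 'a) \<Rightarrow> ('a \<Rightarrow> 'k) \<Rightarrow> bool" where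
  "lform s f \<longleftrightarrow> (\<forall>x y. f (x + y) = f x + f y) \<and> (\<forall>c x. f (s c x) = c * f x)"

definition bform :: "('k::field \<Rightarrow> 'a::ab_group_add \<Rightarrow> 'a) \<Rightarrow> ('k \<Rightarrow> 'b::ab_group_add \<Rightarrow> 'b)
    \<Rightarrow> ('a \<Rightarrow> 'b \<Rightarrow> 'k) \<Rightarrow> bool" where
  "bform sa sb \<phi> \<longleftrightarrow> (\<forall>b. lform sa (\<lambda>a. \<phi> a b)) \<and> (\<forall>a. lform sb (\<phi> a))"

definition tform :: "('k::field \<Rightarrow> 'a::ab_group_add \<Rightarrow> 'a) \<Rightarrow> ('k \<Rightarrow> 'b::ab_group_add \<Rightarrow> 'b)
    \<Rightarrow> ('k \<Rightarrow> 'c::ab_group_add \<Rightarrow> 'c) \<Rightarrow> ('a \<Rightarrow> 'b \<Rightarrow> 'c \<Rightarrow> 'k) \<Rightarrow> bool" where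
  "tform sa sb sc \<phi> \<longleftrightarrow> (\<forall>b c. lform sa (\<lambda>a. \<phi> a b c)) \<and> (\<forall>a. bform sb sc (\<phi> a))"

lemmas form_defs = tform_def bform_def lform_def

lemma vector_space_field: "Vector_Spaces.vector_space ((*) :: 'k::field \<Rightarrow> 'k \<Rightarrow> 'k)"
  by unfold_locales (auto simp: algebra_simps)

lemma linear_functional_iff_lform:
  "Vector_Spaces.vector_space s \<Longrightarrow> Vector_Spaces.linear s (*) f \<longleftrightarrow> lform s f"
  by (simp add: Vector_Spaces.linear_iff vector_space_field lform_def)

lemma lform_zero: "lform s f \<Longrightarrow> f 0 = 0"
  by (metis add_cancel_right_right lform_def)

lemma lform_sum:
  assumes "lform s f"
  shows "f (\<Sum>e\<in>E. s (r e) (v e)) = (\<Sum>e\<in>E. r e * f (v e))"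
  using assms lform_zero[OF assms]
  by (induction E rule: infinite_finite_induct) (simp_all add: lform_def)

text \<open>Finitely many vectors involve finitely many basis elements, while the coordinate
  functionals stay defined on the whole space. This reduces a multilinear form on the entries of a
  finite list to products of functionals, in any dimension.\<close>

lemma finite_coordinates:
  assumes "Vector_Spaces.vector_space s" "finite A"
  obtains E r where "finite E" "\<And>e. lform s (r e)" "\<And>a. a \<in> A \<Longrightarrow> (\<Sum>e\<in>E. s (r e a) e) = a"
proof -
  interpret vector_space s by fact
  \<comment> \<open>Extending the empty independent set yields a basis of the whole space.\<close>
  define C where "C = extend_basis {}"
  have C: "independent C" "span C = UNIV"
    unfolding C_def using independent_extend_basis span_extend_basis independent_empty by blast+
  let ?r = "\<lambda>e a. representation C a e"
  define E where "E = (\<Union>a\<in>A. {e. ?r e a \<noteq> 0})"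
  have "finite E"
    unfolding E_def using \<open>finite A\<close> finite_representation by blast
  moreover have "lform s (?r e)" for e
    using linear_representation[OF C] linear_functional_iff_lform[OF assms(1)] by blast
  moreover have "(\<Sum>e\<in>E. s (?r e a) e) = a" if "a \<in> A" for a
  proof -
    have "(\<Sum>e | ?r e a \<noteq> 0. s (?r e a) e) = a"
      using sum_nonzero_representation_eq[of C a] C by auto
    moreover have "(\<Sum>e | ?r e a \<noteq> 0. s (?r e a) e) = (\<Sum>e\<in>E. s (?r e a) e)"
      by (rule sum.mono_neutral_left) (use \<open>finite E\<close> that in \<open>auto simp: E_def\<close>)
    ultimately show ?thesis by simp
  qed
  ultimately show thesis by (rule that)
qed

text \<open>Coordinate functionals suffice. Equations between vectors thereby become scalar
  equations, to which \<open>tsum\<close> identities apply.\<close>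

lemma lform_separates:
  assumes "Vector_Spaces.vector_space s" and "\<And>f. lform s f \<Longrightarrow> f x = f y"
  shows "x = y"
proof -
  have fin: "finite {x, y}" by simp
  obtain E r where E: "finite E" "\<And>e. lform s (r e)" "\<And>a. a \<in> {x, y} \<Longrightarrow> (\<Sum>e\<in>E. s (r e a) e) = a"
    by (rule finite_coordinates[OF assms(1) fin]) (rule that)
  have "x = (\<Sum>e\<in>E. s (r e x) e)"
    by (rule E(3)[symmetric]) simp
  also have "\<dots> = (\<Sum>e\<in>E. s (r e y) e)"
    by (simp only: assms(2)[OF E(2)])
  also have "\<dots> = y"
    by (rule E(3)) simp
  finally show ?thesis .
qed

text \<open>With \<open>Delta h\<close> as index list, \<open>tsum\<close> is Sweedler notation in continuation-passing style:
  tensor identities become identities between nested \<open>tsum\<close>s applied to an arbitrary multilinear form.\<close>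

definition tsum :: "('a \<times> 'b) list \<Rightarrow> ('a \<Rightarrow> 'b \<Rightarrow> 'k::comm_semiring_0) \<Rightarrow> 'k" where
  "tsum xs \<phi> = sum_list (map (\<lambda>(a, b). \<phi> a b) xs)"

definition tsum3 :: "('a \<times> 'b \<times> 'c) list \<Rightarrow> ('a \<Rightarrow> 'b \<Rightarrow> 'c \<Rightarrow> 'k::comm_semiring_0) \<Rightarrow> 'k" where
  "tsum3 xs \<phi> = sum_list (map (\<lambda>(a, b, c). \<phi> a b c) xs)"

lemma tsum_Nil [simp]: "tsum [] \<phi> = 0"
  and tsum_Cons [simp]: "tsum (p # xs) \<phi> = \<phi> (fst p) (snd p) + tsum xs \<phi>"
  and tsum_append: "tsum (xs @ ys) \<phi> = tsum xs \<phi> + tsum ys \<phi>"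
  by (simp_all add: tsum_def case_prod_beta)

lemma tsum3_Nil [simp]: "tsum3 [] \<phi> = 0"
  and tsum3_Cons [simp]: "tsum3 (p # xs) \<phi> = \<phi> (fst p) (fst (snd p)) (snd (snd p)) + tsum3 xs \<phi>"
  and tsum3_append: "tsum3 (xs @ ys) \<phi> = tsum3 xs \<phi> + tsum3 ys \<phi>"
  by (simp_all add: tsum3_def case_prod_beta)

lemma tsum_map: "tsum (map g xs) \<phi> = tsum xs (\<lambda>a b. \<phi> (fst (g (a, b))) (snd (g (a, b))))"
  by (induction xs) auto

lemma tsum3_map:
  "tsum3 (map g xs) \<phi> = tsum xs (\<lambda>a b. \<phi> (fst (g (a, b))) (fst (snd (g (a, b)))) (snd (snd (g (a, b)))))"
  by (induction xs) auto

lemma tsum_concat_map: "tsum (concat (map g xs)) \<phi> = tsum xs (\<lambda>a b. tsum (g (a, b)) \<phi>)"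
  by (induction xs) (auto simp: tsum_append)

lemma tsum3_concat_map: "tsum3 (concat (map g xs)) \<phi> = tsum xs (\<lambda>a b. tsum3 (g (a, b)) \<phi>)"
  by (induction xs) (auto simp: tsum3_append)

lemma tsum_concat_map3: "tsum (concat (map g xs)) \<phi> = tsum3 xs (\<lambda>a b c. tsum (g (a, b, c)) \<phi>)"
  by (induction xs) (auto simp: tsum_append)

lemmas tsum_lists = tsum_append tsum3_append tsum_map tsum3_map tsum_concat_map tsum3_concat_map tsum_concat_map3

section \<open>Linearity and reordering of nested sums\<close>

lemma tsum_add: "tsum xs (\<lambda>a b. F a b + G a b) = tsum xs F + tsum xs G"
  by (induction xs) (auto simp: algebra_simps)

lemma tsum_scale: "tsum xs (\<lambda>a b. c * F a b) = c * tsum xs F"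
  for c :: "'k::comm_semiring_0"
  by (induction xs) (auto simp: algebra_simps)

lemma tsum_scale_right: "tsum xs (\<lambda>a b. F a b * c) = tsum xs F * c"
  for c :: "'k::comm_semiring_0"
  by (induction xs) (auto simp: algebra_simps)

lemma tsum_zero: "tsum xs (\<lambda>a b. 0) = 0"
  by (induction xs) auto

lemma tsum_swap: "tsum xs (\<lambda>a b. tsum ys (\<lambda>c d. \<phi> a b c d)) = tsum ys (\<lambda>c d. tsum xs (\<lambda>a b. \<phi> a b c d))"
  by (induction xs) (auto simp: tsum_add tsum_zero)

text \<open>At the point of use all four lists are \<open>R\<close>, so a swap cannot be steered by
  naming the list. The permutation is fixed here once, for distinct variables.\<close>

lemma tsum_permute4:
  "tsum ws (\<lambda>a b. tsum xs (\<lambda>c d. tsum ys (\<lambda>e f. tsum zs (\<lambda>g h. F a b c d e f g h))))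
    = tsum ys (\<lambda>e f. tsum xs (\<lambda>c d. tsum zs (\<lambda>g h. tsum ws (\<lambda>a b. F a b c d e f g h))))"
  by (simp only: tsum_swap[of ws]) (simp only: tsum_swap[of xs ys])

lemma tsum_permute4':
  "tsum ws (\<lambda>a b. tsum xs (\<lambda>c d. tsum ys (\<lambda>e f. tsum zs (\<lambda>g h. F a b c d e f g h))))
    = tsum ys (\<lambda>e f. tsum ws (\<lambda>a b. tsum zs (\<lambda>g h. tsum xs (\<lambda>c d. F a b c d e f g h))))"
  by (simp only: tsum_swap[of xs]) (simp only: tsum_swap[of ws ys])

lemma tsum_cong: "(\<And>a b. F a b = G a b) \<Longrightarrow> tsum xs F = tsum xs G"
  by presburger

lemma tsum_sum: "tsum xs (\<lambda>a b. \<Sum>e\<in>E. F e a b) = (\<Sum>e\<in>E. tsum xs (F e))"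
  by (induction xs) (simp_all add: sum.distrib)

lemma tsum3_sum: "tsum3 xs (\<lambda>a b c. \<Sum>e\<in>E. F e a b c) = (\<Sum>e\<in>E. tsum3 xs (F e))"
  by (induction xs) (auto simp: sum.distrib)

text \<open>Membership matters when the two integrands agree only on the entries of the list, for
  instance on central elements or on linear functionals.\<close>

lemma tsum_cong_set: "(\<And>a b. (a, b) \<in> set xs \<Longrightarrow> F a b = G a b) \<Longrightarrow> tsum xs F = tsum xs G"
  unfolding tsum_def by (rule arg_cong[where f = sum_list], rule map_cong) auto

lemma tsum3_cong_set:
  "(\<And>a b c. (a, b, c) \<in> set xs \<Longrightarrow> F a b c = G a b c) \<Longrightarrow> tsum3 xs F = tsum3 xs G"
  unfolding tsum3_def by (rule arg_cong[where f = sum_list], rule map_cong) auto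

section \<open>Equality of tensors as agreement on all multilinear forms\<close>

lemma lform_tsum:
  assumes "lform s f"
  shows "f (sum_list (map (\<lambda>(a, b). g a b) xs)) = tsum xs (\<lambda>a b. f (g a b))"
  using assms lform_zero[OF assms] by (induction xs) (auto simp: lform_def)

text \<open>\<open>ten2_eq\<close> tests only products of two functionals. On finitely many entries
  every bilinear form is a finite sum of such products: expand the first argument in coordinates,
  and each \<open>\<phi> e\<close> is a functional of the second.\<close>

lemma ten2_eq_iff_bform:
  assumes va: "Vector_Spaces.vector_space sa" and vb: "Vector_Spaces.vector_space sb"
  shows "ten2_eq sa sb xs ys \<longleftrightarrow> (\<forall>\<phi>. bform sa sb \<phi> \<longrightarrow> tsum xs \<phi> = tsum ys \<phi>)"
proof
  assume eq: "ten2_eq sa sb xs ys"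
  show "\<forall>\<phi>. bform sa sb \<phi> \<longrightarrow> tsum xs \<phi> = tsum ys \<phi>"
  proof (intro allI impI)
    fix \<phi> assume \<phi>: "bform sa sb \<phi>"
    have fin: "finite (fst ` (set xs \<union> set ys))" by simp
    obtain E r where E: "finite E" "\<And>e. lform sa (r e)"
        "\<And>a. a \<in> fst ` (set xs \<union> set ys) \<Longrightarrow> (\<Sum>e\<in>E. sa (r e a) e) = a"
      by (rule finite_coordinates[OF va fin]) (rule that)
    have *: "tsum zs \<phi> = (\<Sum>e\<in>E. tsum zs (\<lambda>a b. r e a * \<phi> e b))"
      if "set zs \<subseteq> set xs \<union> set ys" for zs
    proof -
      have "\<phi> a b = (\<Sum>e\<in>E. r e a * \<phi> e b)" if "(a, b) \<in> set zs" for a b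
      proof -
        have "a \<in> fst ` (set xs \<union> set ys)"
          using that \<open>set zs \<subseteq> _\<close> by force
        then have "\<phi> a b = \<phi> (\<Sum>e\<in>E. sa (r e a) e) b"
          by (simp add: E(3))
        also have "\<dots> = (\<Sum>e\<in>E. r e a * \<phi> e b)"
          using lform_sum[of sa "\<lambda>a. \<phi> a b"] \<phi> by (simp add: bform_def)
        finally show ?thesis .
      qed
      then have "tsum zs \<phi> = tsum zs (\<lambda>a b. \<Sum>e\<in>E. r e a * \<phi> e b)"
        by (rule tsum_cong_set)
      then show ?thesis by (simp add: tsum_sum)
    qed
    have "tsum xs (\<lambda>a b. r e a * \<phi> e b) = tsum ys (\<lambda>a b. r e a * \<phi> e b)" for e
      using eq \<phi> E(2)[of e] unfolding ten2_eq_def tsum_def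
      by (simp add: linear_functional_iff_lform va vb bform_def)
    then show "tsum xs \<phi> = tsum ys \<phi>" by (simp add: *)
  qed
next
  assume "\<forall>\<phi>. bform sa sb \<phi> \<longrightarrow> tsum xs \<phi> = tsum ys \<phi>"
  then show "ten2_eq sa sb xs ys"
    unfolding ten2_eq_def tsum_def
    by (auto simp: linear_functional_iff_lform va vb bform_def lform_def algebra_simps)
qed

text \<open>As for two factors, with coordinates in the first two arguments; the third is already
  covered by the functionals \<open>\<phi> e g\<close>.\<close>

lemma ten3_eq_iff_tform:
  assumes va: "Vector_Spaces.vector_space sa" and vb: "Vector_Spaces.vector_space sb"
    and vc: "Vector_Spaces.vector_space sc"
  shows "ten3_eq sa sb sc xs ys \<longleftrightarrow> (\<forall>\<phi>. tform sa sb sc \<phi> \<longrightarrow> tsum3 xs \<phi> = tsum3 ys \<phi>)"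
proof
  assume eq: "ten3_eq sa sb sc xs ys"
  show "\<forall>\<phi>. tform sa sb sc \<phi> \<longrightarrow> tsum3 xs \<phi> = tsum3 ys \<phi>"
  proof (intro allI impI)
    fix \<phi> assume \<phi>: "tform sa sb sc \<phi>"
    have fin: "finite (fst ` (set xs \<union> set ys))" by simp
    obtain E r where E: "finite E" "\<And>e. lform sa (r e)"
        "\<And>a. a \<in> fst ` (set xs \<union> set ys) \<Longrightarrow> (\<Sum>e\<in>E. sa (r e a) e) = a"
      by (rule finite_coordinates[OF va fin]) (rule that)
    have fin: "finite ((fst \<circ> snd) ` (set xs \<union> set ys))" by simp
    obtain G q where G: "finite G" "\<And>e. lform sb (q e)"
        "\<And>a. a \<in> (fst \<circ> snd) ` (set xs \<union> set ys) \<Longrightarrow> (\<Sum>e\<in>G. sb (q e a) e) = a"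
      by (rule finite_coordinates[OF vb fin]) (rule that)
    have *: "tsum3 zs \<phi> = (\<Sum>e\<in>E. \<Sum>g\<in>G. tsum3 zs (\<lambda>a b c. r e a * q g b * \<phi> e g c))"
      if "set zs \<subseteq> set xs \<union> set ys" for zs
    proof -
      have "\<phi> a b c = (\<Sum>e\<in>E. \<Sum>g\<in>G. r e a * q g b * \<phi> e g c)" if "(a, b, c) \<in> set zs" for a b c
      proof -
        have "a \<in> fst ` (set xs \<union> set ys)" "b \<in> (fst \<circ> snd) ` (set xs \<union> set ys)"
          using that \<open>set zs \<subseteq> _\<close> by force+
        then have a: "(\<Sum>e\<in>E. sa (r e a) e) = a" and b: "(\<Sum>g\<in>G. sb (q g b) g) = b"
          by (simp_all only: E(3) G(3))
        have "\<phi> a b c = \<phi> (\<Sum>e\<in>E. sa (r e a) e) b c" using a by simp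
        also have "\<dots> = (\<Sum>e\<in>E. r e a * \<phi> e b c)"
          using \<phi> by (simp add: lform_sum[of sa "\<lambda>a. \<phi> a b c"] tform_def)
        also have "\<dots> = (\<Sum>e\<in>E. r e a * \<phi> e (\<Sum>g\<in>G. sb (q g b) g) c)" using b by simp
        also have "\<dots> = (\<Sum>e\<in>E. r e a * (\<Sum>g\<in>G. q g b * \<phi> e g c))"
          using \<phi> by (simp add: lform_sum[of sb "\<lambda>b. \<phi> _ b c"] tform_def bform_def)
        finally show ?thesis by (simp add: sum_distrib_left mult.assoc)
      qed
      then have "tsum3 zs \<phi> = tsum3 zs (\<lambda>a b c. \<Sum>e\<in>E. \<Sum>g\<in>G. r e a * q g b * \<phi> e g c)"
        by (rule tsum3_cong_set)
      then show ?thesis by (simp add: tsum3_sum)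
    qed
    have "tsum3 xs (\<lambda>a b c. r e a * q g b * \<phi> e g c) = tsum3 ys (\<lambda>a b c. r e a * q g b * \<phi> e g c)" for e g
      using eq \<phi> E(2)[of e] G(2)[of g] unfolding ten3_eq_def tsum3_def
      by (simp add: linear_functional_iff_lform va vb vc tform_def bform_def)
    then show "tsum3 xs \<phi> = tsum3 ys \<phi>" by (simp add: *)
  qed
next
  assume "\<forall>\<phi>. tform sa sb sc \<phi> \<longrightarrow> tsum3 xs \<phi> = tsum3 ys \<phi>"
  then show "ten3_eq sa sb sc xs ys"
    unfolding ten3_eq_def tsum3_def
    by (auto simp: linear_functional_iff_lform va vb vc tform_def bform_def lform_def algebra_simps)
qed

section \<open>Hopf algebras\<close>

locale hopf =
  fixes sH :: "'k::field \<Rightarrow> 'h::ring_1 \<Rightarrow> 'h"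
    and Delta :: "'h \<Rightarrow> ('h \<times> 'h) list" and eps :: "'h \<Rightarrow> 'k" and S :: "'h \<Rightarrow> 'h"
  assumes hopf_algebra: "hopf_algebra sH Delta eps S"
begin

abbreviation "lf \<equiv> lform sH"
abbreviation "bf \<equiv> bform sH sH"
abbreviation "tf \<equiv> tform sH sH sH"

section \<open>The Hopf algebra axioms under multilinear forms\<close>

lemma vector_space_H: "Vector_Spaces.vector_space sH"
  using hopf_algebra by (simp add: hopf_algebra_def)

lemma scale_mult: "sH c x * y = sH c (x * y)" "x * sH c y = sH c (x * y)"
  using hopf_algebra unfolding hopf_algebra_def by metis+

lemma S_add: "S (x + y) = S x + S y" and S_scale: "S (sH c x) = sH c (S x)"
  using hopf_algebra by (auto simp: hopf_algebra_def Vector_Spaces.linear_iff)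

lemma eps_add: "eps (x + y) = eps x + eps y" and eps_scale: "eps (sH c x) = c * eps x"
  and eps_mult: "eps (x * y) = eps x * eps y" and eps_one: "eps 1 = 1"
  using hopf_algebra by (auto simp: hopf_algebra_def Vector_Spaces.linear_iff)

lemma ten2_eqD: "ten2_eq sH sH xs ys \<Longrightarrow> bf \<phi> \<Longrightarrow> tsum xs \<phi> = tsum ys \<phi>"
  using ten2_eq_iff_bform[OF vector_space_H vector_space_H] by blast

lemma ten3_eqD: "ten3_eq sH sH sH xs ys \<Longrightarrow> tf \<phi> \<Longrightarrow> tsum3 xs \<phi> = tsum3 ys \<phi>"
  using ten3_eq_iff_tform[OF vector_space_H vector_space_H vector_space_H] by blast

lemma Delta_add: "bf \<phi> \<Longrightarrow> tsum (Delta (x + y)) \<phi> = tsum (Delta x) \<phi> + tsum (Delta y) \<phi>"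
  using hopf_algebra ten2_eqD[of "Delta (x + y)" "Delta x @ Delta y" \<phi>]
  by (simp add: hopf_algebra_def tsum_lists)

lemma Delta_scale:
  assumes "bf \<phi>" shows "tsum (Delta (sH c x)) \<phi> = c * tsum (Delta x) \<phi>"
proof -
  have "tsum (Delta (sH c x)) \<phi> = tsum (map (\<lambda>(a,b). (sH c a, b)) (Delta x)) \<phi>"
    using hopf_algebra by (intro ten2_eqD assms) (simp add: hopf_algebra_def)
  also have "\<dots> = c * tsum (Delta x) \<phi>"
    using assms by (simp add: tsum_lists form_defs flip: tsum_scale)
  finally show ?thesis .
qed

text \<open>These equations let \<open>simp\<close> discharge the multilinearity side conditions.
  With \<open>Delta_add\<close> and \<open>Delta_scale\<close> among them, a Sweedler sum nested
  inside a form is recognised as linear in the element that it expands.\<close>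

lemmas multilinear = form_defs algebra_simps tsum_add tsum_scale scale_mult S_add S_scale
  eps_add eps_scale Delta_add Delta_scale

lemma coassoc:
  assumes "tf \<phi>"
  shows "tsum (Delta h) (\<lambda>x c. tsum (Delta x) (\<lambda>a b. \<phi> a b c)) = tsum (Delta h) (\<lambda>a x. tsum (Delta x) (\<lambda>b c. \<phi> a b c))"
proof -
  have "ten3_eq sH sH sH (Delta2 Delta h)
            (concat (map (\<lambda>(a,b). map (\<lambda>(b1,b2). (a,b1,b2)) (Delta b)) (Delta h)))"
    using hopf_algebra by (simp add: hopf_algebra_def)
  from ten3_eqD[OF this assms] show ?thesis
    by (simp add: Delta2_def tsum_lists case_prod_beta)
qed

lemma counit_left: "lf f \<Longrightarrow> tsum (Delta h) (\<lambda>a b. eps a * f b) = f h"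
  and counit_right: "lf f \<Longrightarrow> tsum (Delta h) (\<lambda>a b. eps b * f a) = f h"
  and antipode_left: "lf f \<Longrightarrow> tsum (Delta h) (\<lambda>a b. f (S a * b)) = eps h * f 1"
  and antipode_right: "lf f \<Longrightarrow> tsum (Delta h) (\<lambda>a b. f (a * S b)) = eps h * f 1"
proof -
  assume f: "lf f"
  note h = hopf_algebra[unfolded hopf_algebra_def]
  from h have "f (sum_list (map (\<lambda>(a,b). sH (eps a) b) (Delta h))) = f h"
    "f (sum_list (map (\<lambda>(a,b). sH (eps b) a) (Delta h))) = f h"
    "f (sum_list (map (\<lambda>(a,b). S a * b) (Delta h))) = f (sH (eps h) 1)"
    "f (sum_list (map (\<lambda>(a,b). a * S b) (Delta h))) = f (sH (eps h) 1)"
    by simp_all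
  with f show "tsum (Delta h) (\<lambda>a b. eps a * f b) = f h" "tsum (Delta h) (\<lambda>a b. eps b * f a) = f h"
    "tsum (Delta h) (\<lambda>a b. f (S a * b)) = eps h * f 1" "tsum (Delta h) (\<lambda>a b. f (a * S b)) = eps h * f 1"
    by (simp_all only: lform_tsum[OF f]) (simp_all add: lform_def)
qed

lemma Delta_mult:
  assumes "bf \<phi>"
  shows "tsum (Delta (x * y)) \<phi> = tsum (Delta x) (\<lambda>x1 x2. tsum (Delta y) (\<lambda>y1 y2. \<phi> (x1 * y1) (x2 * y2)))"
proof -
  have "ten2_eq sH sH (Delta (x * y)) (tmult (Delta x) (Delta y))"
    using hopf_algebra by (simp add: hopf_algebra_def)
  from ten2_eqD[OF this assms] show ?thesis
    by (simp add: tmult_def tsum_lists case_prod_beta)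
qed

lemma Delta_one: "bf \<phi> \<Longrightarrow> tsum (Delta 1) \<phi> = \<phi> 1 1"
  using hopf_algebra ten2_eqD[of "Delta 1" "[(1,1)]" \<phi>] by (simp add: hopf_algebra_def)

section \<open>Cancellation by the antipode; the antipode reverses products and coproducts\<close>

lemma cancel_S_left:
  assumes "bf \<phi>"
  shows "tsum (Delta h) (\<lambda>a x. tsum (Delta x) (\<lambda>b c. \<phi> (S a * b) c)) = \<phi> 1 h"
    and "tsum (Delta h) (\<lambda>a x. tsum (Delta x) (\<lambda>b c. \<phi> (a * S b) c)) = \<phi> 1 h"
proof -
  note m = multilinear assms[unfolded form_defs]
  show "tsum (Delta h) (\<lambda>a x. tsum (Delta x) (\<lambda>b c. \<phi> (S a * b) c)) = \<phi> 1 h"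
    by (subst coassoc[symmetric]) (simp_all add: m antipode_left[of "\<lambda>u. \<phi> u _"] counit_left)
  show "tsum (Delta h) (\<lambda>a x. tsum (Delta x) (\<lambda>b c. \<phi> (a * S b) c)) = \<phi> 1 h"
    by (subst coassoc[symmetric]) (simp_all add: m antipode_right[of "\<lambda>u. \<phi> u _"] counit_left)
qed

lemma cancel_S_right:
  assumes "bf \<phi>"
  shows "tsum (Delta h) (\<lambda>a x. tsum (Delta x) (\<lambda>b c. \<phi> a (S b * c))) = \<phi> h 1"
    and "tsum (Delta h) (\<lambda>a x. tsum (Delta x) (\<lambda>b c. \<phi> a (b * S c))) = \<phi> h 1"
proof -
  note m = multilinear assms[unfolded form_defs]
  show "tsum (Delta h) (\<lambda>a x. tsum (Delta x) (\<lambda>b c. \<phi> a (S b * c))) = \<phi> h 1"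
    by (simp add: m antipode_left counit_right[of "\<lambda>u. \<phi> u _"])
  show "tsum (Delta h) (\<lambda>a x. tsum (Delta x) (\<lambda>b c. \<phi> a (b * S c))) = \<phi> h 1"
    by (simp add: m antipode_right counit_right[of "\<lambda>u. \<phi> u _"])
qed

lemma H_eqI: "(\<And>f. lf f \<Longrightarrow> f x = f y) \<Longrightarrow> x = y"
  using lform_separates[OF vector_space_H] by blast

lemma S_one: "S 1 = 1"
proof (rule H_eqI)
  fix f assume f: "lf f"
  have "tsum (Delta 1) (\<lambda>a b. f (S a * b)) = f (S 1 * 1)"
    using f by (intro Delta_one) (simp add: multilinear)
  then show "f (S 1) = f 1"
    by (simp add: antipode_left[OF f] eps_one)
qed

lemma eps_S: "eps (S h) = eps h"
proof -
  have "eps (S h) = tsum (Delta h) (\<lambda>a b. eps b * eps (S a))"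
    by (subst counit_right) (simp_all add: multilinear)
  also have "\<dots> = tsum (Delta h) (\<lambda>a b. eps (S a * b))"
    by (simp add: eps_mult mult.commute)
  also have "\<dots> = eps h"
    by (subst antipode_left) (simp_all add: multilinear eps_one)
  finally show ?thesis .
qed

text \<open>Both sides arise from \<open>S (x\<^sub>1 y\<^sub>1) x\<^sub>2 y\<^sub>2 S y\<^sub>3 S x\<^sub>3\<close> by cancelling from the right or from the left.\<close>

lemma S_mult: "S (x * y) = S y * S x"
proof (rule H_eqI)
  fix f assume f: "lf f"
  note m = multilinear f[unfolded form_defs]
  let ?F = "\<lambda>x1 x2 x3 y1 y2 y3. f (S (x1 * y1) * (x2 * y2) * (S y3 * S x3))"
  let ?X = "tsum (Delta x) (\<lambda>x1 x'. tsum (Delta x') (\<lambda>x2 x3. tsum (Delta y) (\<lambda>y1 y'.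
      tsum (Delta y') (\<lambda>y2 y3. ?F x1 x2 x3 y1 y2 y3))))"
  have 1: "tsum (Delta y) (\<lambda>y1 y'. tsum (Delta y') (\<lambda>y2 y3. ?F x1 x2 x3 y1 y2 y3))
      = f (S (x1 * y) * (x2 * S x3))" for x1 x2 x3
    using cancel_S_right(2)[of "\<lambda>p q. f (S (x1 * p) * (x2 * q * S x3))" y]
    by (simp add: m)
  have 2: "?X = f (S (x * y))"
    unfolding 1 using cancel_S_right(2)[of "\<lambda>p q. f (S (p * y) * q)" x] by (simp add: m)
  have 3: "tsum (Delta y) (\<lambda>y1 y'. tsum (Delta y') (\<lambda>y2 y3. ?F x1 x2 x3 y1 y2 y3))
     = tsum (Delta y) (\<lambda>y' y3. tsum (Delta y') (\<lambda>y1 y2. ?F x1 x2 x3 y1 y2 y3))" for x1 x2 x3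
    by (rule coassoc[symmetric]) (simp add: m)
  have "?X = tsum (Delta x) (\<lambda>x' x3. tsum (Delta x') (\<lambda>x1 x2.
      tsum (Delta y) (\<lambda>y' y3. tsum (Delta y') (\<lambda>y1 y2. ?F x1 x2 x3 y1 y2 y3))))"
    unfolding 3 by (rule coassoc[symmetric]) (simp add: m)
  also have "\<dots> = tsum (Delta x) (\<lambda>x' x3. tsum (Delta y) (\<lambda>y' y3. tsum (Delta x') (\<lambda>x1 x2.
       tsum (Delta y') (\<lambda>y1 y2. ?F x1 x2 x3 y1 y2 y3))))"
    by (subst tsum_swap) simp
  also have "\<dots> = tsum (Delta x) (\<lambda>x' x3. tsum (Delta y) (\<lambda>y' y3.
       tsum (Delta (x' * y')) (\<lambda>p q. f (S p * q * (S y3 * S x3)))))"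
    by (subst Delta_mult) (simp_all add: m)
  also have "\<dots> = tsum (Delta x) (\<lambda>x' x3. tsum (Delta y) (\<lambda>y' y3. eps (x' * y') * f (S y3 * S x3)))"
    by (subst antipode_left[of "\<lambda>u. f (u * _)"]) (simp_all add: m)
  also have "\<dots> = f (S y * S x)"
    by (simp add: eps_mult mult.assoc tsum_scale counit_left[of "\<lambda>u. f (S u * _)"]
        counit_left[of "\<lambda>u. f (_ * S u)"] m)
  finally show "f (S (x * y)) = f (S y * S x)" using 2 by simp
qed

text \<open>Uniqueness of convolution inverses for maps from \<open>H\<close> to its tensor square:
  \<open>S\<close> followed by \<open>Delta\<close>, and \<open>Delta\<close> followed by the flip
  and \<open>S\<close> on both legs, are both inverse to \<open>Delta\<close>. \<open>?X\<close> is
  the triple product of the first inverse, \<open>Delta\<close> and the second inverse.\<close>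

lemma Delta_S:
  assumes "bf \<phi>"
  shows "tsum (Delta (S h)) \<phi> = tsum (Delta h) (\<lambda>a b. \<phi> (S b) (S a))"
proof -
  note m = multilinear assms[unfolded form_defs]
  let ?F = "\<lambda>p q r s u v. \<phi> (p * (r * S v)) (q * (s * S u))"
  let ?X = "tsum (Delta h) (\<lambda>h1 x. tsum (Delta x) (\<lambda>h2 z. tsum (Delta (S h1)) (\<lambda>p q.
     tsum (Delta h2) (\<lambda>r s. tsum (Delta z) (\<lambda>u v. ?F p q r s u v)))))"
  \<comment> \<open>The last two factors collapse to the counit. Among the four legs of
    \<open>x\<close> the inner pair \<open>s * S u\<close> cancels first, which leaves the outer
    pair \<open>r * S v\<close> adjacent.\<close>
  have 1: "tsum (Delta x) (\<lambda>h2 z. tsum (Delta h2) (\<lambda>r s. tsum (Delta z) (\<lambda>u v. ?F p q r s u v)))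
      = eps x * \<phi> p q" for x p q
  proof -
    have "tsum (Delta x) (\<lambda>h2 z. tsum (Delta h2) (\<lambda>r s. tsum (Delta z) (\<lambda>u v. ?F p q r s u v)))
       = tsum (Delta x) (\<lambda>r t. tsum (Delta t) (\<lambda>s z. tsum (Delta z) (\<lambda>u v. ?F p q r s u v)))"
      by (rule coassoc) (simp add: m)
    also have "\<dots> = tsum (Delta x) (\<lambda>r t. \<phi> (p * (r * S t)) (q * 1))"
      by (subst cancel_S_left(2)[of "\<lambda>c v. \<phi> (p * (_ * S v)) (q * c)"]) (simp_all add: m)
    also have "\<dots> = eps x * \<phi> p q"
      by (subst antipode_right[of "\<lambda>u. \<phi> (p * u) (q * 1)"]) (simp_all add: m)
    finally show ?thesis .
  qed
  have "?X = tsum (Delta h) (\<lambda>h1 x. tsum (Delta (S h1)) (\<lambda>p q. tsum (Delta x) (\<lambda>h2 z.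
     tsum (Delta h2) (\<lambda>r s. tsum (Delta z) (\<lambda>u v. ?F p q r s u v)))))"
    by (subst tsum_swap) simp
  also have "\<dots> = tsum (Delta h) (\<lambda>h1 x. eps x * tsum (Delta (S h1)) \<phi>)"
    unfolding 1 by (simp add: tsum_scale)
  also have "\<dots> = tsum (Delta (S h)) \<phi>"
    by (rule counit_right) (simp add: m)
  finally have 2: "?X = tsum (Delta (S h)) \<phi>" .
  \<comment> \<open>Bracketed the other way, the first two factors combine to
    \<open>Delta (S h1 * h2)\<close>, and the antipode axiom applies inside
    \<open>Delta\<close>.\<close>
  have "?X = tsum (Delta h) (\<lambda>x z. tsum (Delta x) (\<lambda>h1 h2. tsum (Delta (S h1)) (\<lambda>p q.
     tsum (Delta h2) (\<lambda>r s. tsum (Delta z) (\<lambda>u v. ?F p q r s u v)))))"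
    by (rule coassoc[symmetric]) (simp add: m)
  also have "\<dots> = tsum (Delta h) (\<lambda>x z. tsum (Delta x) (\<lambda>h1 h2. tsum (Delta (S h1 * h2)) (\<lambda>p q.
     tsum (Delta z) (\<lambda>u v. \<phi> (p * S v) (q * S u)))))"
    by (subst Delta_mult) (simp_all add: m)
  also have "\<dots> = tsum (Delta h) (\<lambda>x z. eps x * tsum (Delta 1) (\<lambda>p q.
     tsum (Delta z) (\<lambda>u v. \<phi> (p * S v) (q * S u))))"
    by (subst antipode_left[of "\<lambda>t. tsum (Delta t) (\<lambda>p q. tsum (Delta _) (\<lambda>u v. \<phi> (p * S v) (q * S u)))"])
      (simp_all add: m)
  also have "\<dots> = tsum (Delta h) (\<lambda>x z. eps x * tsum (Delta z) (\<lambda>u v. \<phi> (S v) (S u)))"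
    by (subst Delta_one) (simp_all add: m)
  also have "\<dots> = tsum (Delta h) (\<lambda>a b. \<phi> (S b) (S a))"
    by (rule counit_left) (simp add: m)
  finally show ?thesis using 2 by simp
qed

end

section \<open>The map nu of a semiquasitriangular Hopf algebra\<close>

locale sqt_hopf = hopf sH Delta eps S
  for sH :: "'k::field \<Rightarrow> 'h::ring_1 \<Rightarrow> 'h"
    and Delta :: "'h \<Rightarrow> ('h \<times> 'h) list" and eps :: "'h \<Rightarrow> 'k" and S :: "'h \<Rightarrow> 'h" +
  fixes R :: "('h \<times> 'h) list"
  assumes semiquasitriangular: "semiquasitriangular sH Delta eps S R"
begin

section \<open>The inverse antipode\<close>

lemma bij_S: "bij S"
  using semiquasitriangular by (simp add: semiquasitriangular_def)

abbreviation "Sinv \<equiv> inv S"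

lemma S_Sinv: "S (Sinv x) = x" and Sinv_S: "Sinv (S x) = x"
  using bij_S by (simp_all add: bij_is_surj surj_f_inv_f bij_is_inj)

lemma Sinv_add: "Sinv (x + y) = Sinv x + Sinv y"
  and Sinv_scale: "Sinv (sH c x) = sH c (Sinv x)"
  and Sinv_mult: "Sinv (x * y) = Sinv y * Sinv x"
  and Sinv_one: "Sinv 1 = 1"
  and eps_Sinv: "eps (Sinv x) = eps x"
  by (metis S_Sinv Sinv_S S_add S_scale S_mult S_one eps_S)+

lemmas multilinear' = multilinear Sinv_add Sinv_scale

lemma Delta_Sinv:
  assumes "bf \<phi>"
  shows "tsum (Delta (Sinv h)) \<phi> = tsum (Delta h) (\<lambda>a b. \<phi> (Sinv b) (Sinv a))"
  using Delta_S[of "\<lambda>a b. \<phi> (Sinv b) (Sinv a)" "Sinv h"] assms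
  by (simp add: S_Sinv Sinv_S multilinear')

text \<open>\<open>Sinv\<close> reverses products, so \<open>Sinv (a * S b) = b * Sinv a\<close>;
  this explains the exchanged order of the two legs.\<close>

lemma Sinv_antipode:
  assumes "lf f"
  shows "tsum (Delta h) (\<lambda>a b. f (b * Sinv a)) = eps h * f 1"
  using antipode_right[of "\<lambda>x. f (Sinv x)" h] assms
  by (simp add: multilinear' Sinv_mult Sinv_S Sinv_one)

text \<open>Every \<open>x\<close> is \<open>Sinv (S x)\<close>, so it is enough to commute
  \<open>z\<close> with \<open>S x\<close> and apply \<open>Sinv\<close>.\<close>

lemma Sinv_center: "z \<in> center \<Longrightarrow> Sinv z \<in> center"
  unfolding center_def by (auto simp: Sinv_S) (metis Sinv_S Sinv_mult)

section \<open>The axioms for R, its counits and its inverse\<close>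

lemma R_1:
  assumes "tf \<phi>"
  shows "tsum R (\<lambda>a b. tsum (Delta a) (\<lambda>a1 a2. \<phi> a1 a2 b))
    = tsum R (\<lambda>a b. tsum R (\<lambda>a' b'. \<phi> a a' (b * b')))"
proof -
  have "ten3_eq sH sH sH
       (concat (map (\<lambda>(a,b). map (\<lambda>(a1,a2). (a1,a2,b)) (Delta a)) R))
       (concat (map (\<lambda>(a,b). map (\<lambda>(a',b'). (a,a',b*b')) R) R))"
    using semiquasitriangular by (simp add: semiquasitriangular_def)
  from ten3_eqD[OF this assms] show ?thesis by (simp add: tsum_lists case_prod_beta)
qed

lemma R_2:
  assumes "tf \<phi>"
  shows "tsum R (\<lambda>a b. tsum (Delta b) (\<lambda>b1 b2. \<phi> a b1 b2))
    = tsum R (\<lambda>a b. tsum R (\<lambda>a' b'. \<phi> (a * a') b' b))"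
proof -
  have "ten3_eq sH sH sH
       (concat (map (\<lambda>(a,b). map (\<lambda>(b1,b2). (a,b1,b2)) (Delta b)) R))
       (concat (map (\<lambda>(a,b). map (\<lambda>(a',b'). (a*a',b',b)) R) R))"
    using semiquasitriangular by (simp add: semiquasitriangular_def)
  from ten3_eqD[OF this assms] show ?thesis by (simp add: tsum_lists case_prod_beta)
qed

lemma R_3:
  assumes "tf \<phi>"
  shows "tsum R (\<lambda>a b. tsum (Delta b) (\<lambda>b1 b2. tsum R (\<lambda>a' b'. \<phi> a (b2 * a') (b1 * b'))))
    = tsum R (\<lambda>a b. tsum (Delta b) (\<lambda>b1 b2. tsum R (\<lambda>a' b'. \<phi> a (a' * b1) (b' * b2))))"
proof -
  have "ten3_eq sH sH sH
       (concat (map (\<lambda>(a,b). concat (map (\<lambda>(b1,b2). map (\<lambda>(a',b'). (a, b2*a', b1*b')) R) (Delta b))) R))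
       (concat (map (\<lambda>(a,b). concat (map (\<lambda>(b1,b2). map (\<lambda>(a',b'). (a, a'*b1, b'*b2)) R) (Delta b))) R))"
    using semiquasitriangular by (simp add: semiquasitriangular_def)
  from ten3_eqD[OF this assms] show ?thesis by (simp add: tsum_lists case_prod_beta)
qed

lemma R_invertible:
  obtains Q where
    "\<And>\<phi>. bf \<phi> \<Longrightarrow> tsum R (\<lambda>a b. tsum Q (\<lambda>c d. \<phi> (a * c) (b * d))) = \<phi> 1 1"
    "\<And>\<phi>. bf \<phi> \<Longrightarrow> tsum R (\<lambda>a b. tsum Q (\<lambda>c d. \<phi> (c * a) (d * b))) = \<phi> 1 1"
proof -
  obtain Q where Q: "ten2_eq sH sH (tmult R Q) [(1,1)]" "ten2_eq sH sH (tmult Q R) [(1,1)]"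
    using semiquasitriangular by (auto simp: semiquasitriangular_def)
  have "tsum R (\<lambda>a b. tsum Q (\<lambda>c d. \<phi> (a * c) (b * d))) = \<phi> 1 1" if "bf \<phi>" for \<phi>
    using ten2_eqD[OF Q(1) that] by (simp add: tmult_def tsum_lists case_prod_beta)
  moreover have "tsum R (\<lambda>a b. tsum Q (\<lambda>c d. \<phi> (c * a) (d * b))) = \<phi> 1 1" if "bf \<phi>" for \<phi>
    using ten2_eqD[OF Q(2) that]
    by (subst tsum_swap) (simp add: tmult_def tsum_lists case_prod_beta)
  ultimately show thesis by (rule that)
qed

text \<open>Let \<open>e\<close> be the sum of \<open>eps a\<close> times \<open>b\<close> over
  \<open>R\<close>. The counit on the first leg of axiom (1) gives
  \<open>R = (1 \<otimes> e) R\<close>, and invertibility of \<open>R\<close> forces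
  \<open>e = 1\<close>.\<close>

lemma R_counit_left:
  assumes "lf f" shows "tsum R (\<lambda>a b. eps a * f b) = f 1"
proof -
  obtain Q where Q: "\<And>\<phi>. bf \<phi> \<Longrightarrow> tsum R (\<lambda>a b. tsum Q (\<lambda>c d. \<phi> (a * c) (b * d))) = \<phi> 1 1"
    by (rule R_invertible) (rule that)
  note m = multilinear' assms[unfolded form_defs]
  have "f 1 = tsum R (\<lambda>a b. tsum Q (\<lambda>c d. eps (a * c) * f (b * d)))"
    by (subst Q[of "\<lambda>p q. eps p * f q"]) (simp_all add: m eps_one)
  also have "\<dots> = tsum R (\<lambda>a b. tsum (Delta a) (\<lambda>a1 a2. eps a1 * tsum Q (\<lambda>c d. eps (a2 * c) * f (b * d))))"
    by (subst counit_left) (simp_all add: m)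
  also have "\<dots> = tsum R (\<lambda>a b. tsum R (\<lambda>a' b'. eps a * tsum Q (\<lambda>c d. eps (a' * c) * f (b * b' * d))))"
    by (rule R_1) (simp add: m)
  also have "\<dots> = tsum R (\<lambda>a b. eps a * tsum R (\<lambda>a' b'. tsum Q (\<lambda>c d. eps (a' * c) * f (b * (b' * d)))))"
    by (simp add: tsum_scale mult.assoc)
  also have "\<dots> = tsum R (\<lambda>a b. eps a * f b)"
    by (subst Q[of "\<lambda>p q. eps p * f (_ * q)"]) (simp_all add: m eps_one)
  finally show ?thesis by simp
qed

text \<open>Axiom (2) multiplies the first legs in the order \<open>a * a'\<close>, so the counit
  now gives \<open>R = R (e \<otimes> 1)\<close> and \<open>R\<close> is cancelled by its inverse on
  the left.\<close>

lemma R_counit_right: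
  assumes "lf f" shows "tsum R (\<lambda>a b. eps b * f a) = f 1"
proof -
  obtain Q where Q: "\<And>\<phi>. bf \<phi> \<Longrightarrow> tsum R (\<lambda>a b. tsum Q (\<lambda>c d. \<phi> (c * a) (d * b))) = \<phi> 1 1"
    by (rule R_invertible) (rule that)
  note m = multilinear' assms[unfolded form_defs]
  have "f 1 = tsum R (\<lambda>a b. tsum Q (\<lambda>c d. eps (d * b) * f (c * a)))"
    by (subst Q[of "\<lambda>p q. eps q * f p"]) (simp_all add: m eps_one)
  also have "\<dots> = tsum R (\<lambda>a b. tsum (Delta b) (\<lambda>b1 b2. eps b1 * tsum Q (\<lambda>c d. eps (d * b2) * f (c * a))))"
    by (subst counit_left) (simp_all add: m)
  also have "\<dots> = tsum R (\<lambda>a b. tsum R (\<lambda>a' b'. eps b' * tsum Q (\<lambda>c d. eps (d * b) * f (c * (a * a')))))"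
    by (rule R_2) (simp add: m)
  also have "\<dots> = tsum R (\<lambda>a' b'. eps b' * tsum R (\<lambda>a b. tsum Q (\<lambda>c d. eps (d * b) * f (c * a * a'))))"
    by (subst tsum_swap) (simp add: tsum_scale mult.assoc)
  also have "\<dots> = tsum R (\<lambda>a b. eps b * f a)"
    by (subst Q[of "\<lambda>p q. eps q * f (p * _)"]) (simp_all add: m eps_one)
  finally show ?thesis by simp
qed

text \<open>The antipode on the first leg inverts \<open>R\<close>: axiom (1) merges the two copies
  into a coproduct of one first leg, and the antipode axiom reduces it to its counit. Hence the
  factors \<open>b\<close> and \<open>S a\<close> in \<open>nu\<close> are the flipped inverse of
  \<open>R\<close>, and \<open>nu\<close> involves a conjugation.\<close>

lemma R_inverse:
  assumes "bf \<phi>"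
  shows "tsum R (\<lambda>a b. tsum R (\<lambda>a' b'. \<phi> (S a * a') (b * b'))) = \<phi> 1 1"
    and "tsum R (\<lambda>a b. tsum R (\<lambda>a' b'. \<phi> (a * S a') (b * b'))) = \<phi> 1 1"
proof -
  note m = multilinear' assms[unfolded form_defs]
  have "tsum R (\<lambda>a b. tsum R (\<lambda>a' b'. \<phi> (S a * a') (b * b'))) =
      tsum R (\<lambda>a b. tsum (Delta a) (\<lambda>a1 a2. \<phi> (S a1 * a2) b))"
    by (rule R_1[symmetric]) (simp add: m)
  also have "\<dots> = tsum R (\<lambda>a b. eps a * \<phi> 1 b)"
    by (subst antipode_left[of "\<lambda>u. \<phi> u _"]) (simp_all add: m)
  also have "\<dots> = \<phi> 1 1" by (rule R_counit_left) (simp add: m)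
  finally show "tsum R (\<lambda>a b. tsum R (\<lambda>a' b'. \<phi> (S a * a') (b * b'))) = \<phi> 1 1" .
  have "tsum R (\<lambda>a b. tsum R (\<lambda>a' b'. \<phi> (a * S a') (b * b'))) =
      tsum R (\<lambda>a b. tsum (Delta a) (\<lambda>a1 a2. \<phi> (a1 * S a2) b))"
    by (rule R_1[symmetric]) (simp add: m)
  also have "\<dots> = tsum R (\<lambda>a b. eps a * \<phi> 1 b)"
    by (subst antipode_right[of "\<lambda>u. \<phi> u _"]) (simp_all add: m)
  also have "\<dots> = \<phi> 1 1" by (rule R_counit_left) (simp add: m)
  finally show "tsum R (\<lambda>a b. tsum R (\<lambda>a' b'. \<phi> (a * S a') (b * b'))) = \<phi> 1 1" .
qed

section \<open>The map nu: centrality, counits, multiplicativity, coassociativity\<close>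

abbreviation "nu \<equiv> nuH Delta S R"

lemma nu_expand:
  "tsum (nu h) \<phi> = tsum (Delta h) (\<lambda>x h3. tsum (Delta x) (\<lambda>h1 h2. tsum R (\<lambda>a b. tsum R (\<lambda>a' b'.
     \<phi> (b * h2 * b') (S h1 * S a * h3 * a')))))"
  by (simp add: nuH_def Delta2_def tsum_lists case_prod_beta)

lemma nu_expand_right:
  assumes "bf \<phi>"
  shows "tsum (nu h) \<phi> = tsum (Delta h) (\<lambda>h1 x. tsum (Delta x) (\<lambda>h2 h3. tsum R (\<lambda>a b. tsum R (\<lambda>a' b'.
     \<phi> (b * h2 * b') (S h1 * S a * h3 * a')))))"
  unfolding nu_expand
  by (rule coassoc) (simp add: multilinear' assms[unfolded form_defs])

lemma nu_add: "bf \<phi> \<Longrightarrow> tsum (nu (x + y)) \<phi> = tsum (nu x) \<phi> + tsum (nu y) \<phi>"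
  and nu_scale: "bf \<phi> \<Longrightarrow> tsum (nu (sH c x)) \<phi> = c * tsum (nu x) \<phi>"
  by (simp_all add: nu_expand multilinear')

lemmas mlin = multilinear' nu_add nu_scale

text \<open>The list \<open>nu h\<close> itself need not have central second entries; axiom (5) only
  provides an equivalent list that does. The form is transported there, commuted entrywise and
  transported back.\<close>

lemma nu_central:
  assumes "bf \<phi>"
  shows "tsum (nu h) (\<lambda>u z. \<phi> u (x * z)) = tsum (nu h) (\<lambda>u z. \<phi> u (z * x))"
proof -
  note m = mlin assms[unfolded form_defs]
  obtain ys where ys: "ten2_eq sH sH (nu h) ys" "\<forall>p\<in>set ys. snd p \<in> center"
    using semiquasitriangular unfolding semiquasitriangular_def by blast
  have "tsum (nu h) (\<lambda>u z. \<phi> u (x * z)) = tsum ys (\<lambda>u z. \<phi> u (x * z))"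
    by (rule ten2_eqD[OF ys(1)]) (simp add: m)
  also have "\<dots> = tsum ys (\<lambda>u z. \<phi> u (z * x))"
    by (rule tsum_cong_set) (use ys(2) in \<open>auto simp: center_def\<close>)
  also have "\<dots> = tsum (nu h) (\<lambda>u z. \<phi> u (z * x))"
    by (rule ten2_eqD[OF ys(1), symmetric]) (simp add: m)
  finally show ?thesis .
qed

text \<open>The counit on the first leg removes both copies of \<open>R\<close> and the middle leg
  of \<open>h\<close>, and \<open>S h1 * h3\<close> is left for the antipode axiom.\<close>

lemma nu_counit_left:
  assumes "lf f"
  shows "tsum (nu h) (\<lambda>u z. eps u * f z) = eps h * f 1"
proof -
  note m = mlin assms[unfolded form_defs]
  have "tsum (nu h) (\<lambda>u z. eps u * f z)
     = tsum (Delta h) (\<lambda>x h3. tsum (Delta x) (\<lambda>h1 h2. eps h2 * tsum R (\<lambda>a b. eps b * tsum R (\<lambda>a' b'. eps b' * f (S h1 * S a * h3 * a')))))"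
    by (simp add: nu_expand eps_mult ac_simps flip: tsum_scale)
  also have "\<dots> = tsum (Delta h) (\<lambda>x h3. tsum (Delta x) (\<lambda>h1 h2. eps h2 * f (S h1 * h3)))"
    by (subst R_counit_right[of "\<lambda>u. f (_ * u)"], simp add: m,
        subst R_counit_right[of "\<lambda>u. f (_ * S u * _ * 1)"]) (simp_all add: m S_one)
  also have "\<dots> = tsum (Delta h) (\<lambda>x h3. f (S x * h3))"
    by (subst counit_right) (simp_all add: m)
  also have "\<dots> = eps h * f 1"
    by (rule antipode_left[OF assms])
  finally show ?thesis .
qed

lemma nu_counit_right:
  assumes "lf f"
  shows "tsum (nu h) (\<lambda>u z. eps z * f u) = f h"
proof -
  note m = mlin assms[unfolded form_defs]
  have "tsum (nu h) (\<lambda>u z. eps z * f u)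
     = tsum (Delta h) (\<lambda>x h3. eps h3 * tsum (Delta x) (\<lambda>h1 h2. eps h1 * tsum R (\<lambda>a b. eps a * tsum R (\<lambda>a' b'. eps a' * f (b * h2 * b')))))"
    by (simp add: nu_expand eps_mult eps_S ac_simps flip: tsum_scale)
  also have "\<dots> = tsum (Delta h) (\<lambda>x h3. eps h3 * tsum (Delta x) (\<lambda>h1 h2. eps h1 * f h2))"
    by (subst R_counit_left[of "\<lambda>u. f (_ * u)"], simp add: m,
        subst R_counit_left[of "\<lambda>u. f (u * _ * 1)"]) (simp_all add: m)
  also have "\<dots> = f h"
    by (simp add: counit_left counit_right assms)
  finally show ?thesis .
qed

lemma nu_one:
  assumes "bf \<phi>" shows "tsum (nu 1) \<phi> = \<phi> 1 1"
proof -
  note m = mlin assms[unfolded form_defs]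
  have "tsum (nu 1) \<phi> = tsum R (\<lambda>a b. tsum R (\<lambda>a' b'. \<phi> (b * b') (S a * a')))"
    by (simp add: nu_expand Delta_one m S_one)
  also have "\<dots> = \<phi> 1 1"
    by (subst R_inverse(1)[of "\<lambda>p q. \<phi> q p"]) (simp_all add: m)
  finally show ?thesis .
qed

text \<open>This orientation of \<open>tsum_swap\<close> gives a normal form: Sweedler sums that do
  not depend on the summand of \<open>R\<close> stand outside the sums over
  \<open>R\<close>.\<close>

lemma Delta_R_swap:
  "tsum R (\<lambda>a b. tsum (Delta h) (\<lambda>x y. F a b x y)) = tsum (Delta h) (\<lambda>x y. tsum R (\<lambda>a b. F a b x y))"
  by (rule tsum_swap)

text \<open>Conjugation is multiplicative because the right-hand \<open>R\<close> of
  \<open>nu h\<close> meets the inverse of \<open>R\<close> at the left of \<open>nu g\<close>.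
  Centrality first has to move \<open>S g1\<close> out of the way.\<close>

lemma nu_mult:
  assumes "bf \<phi>"
  shows "tsum (nu (h * g)) \<phi> = tsum (nu h) (\<lambda>u z. tsum (nu g) (\<lambda>v w. \<phi> (u * v) (z * w)))"
proof -
  note m = mlin assms[unfolded form_defs]
  have "tsum (nu h) (\<lambda>u z. tsum (nu g) (\<lambda>v w. \<phi> (u * v) (z * w)))
    = tsum (Delta g) (\<lambda>x g3. tsum (Delta x) (\<lambda>g1 g2. tsum R (\<lambda>c d. tsum R (\<lambda>c' d'.
        tsum (nu h) (\<lambda>u z. \<phi> (u * (d * g2 * d')) (z * (S g1 * S c * g3 * c')))))))"
    by (subst tsum_swap) (simp only: nu_expand[of g])
  \<comment> \<open>Centrality of \<open>z\<close> puts \<open>S g1\<close> in front, where it will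
    join \<open>S h1\<close> to form \<open>S (h1 * g1)\<close>.\<close>
  also have "\<dots> = tsum (Delta g) (\<lambda>x g3. tsum (Delta x) (\<lambda>g1 g2. tsum R (\<lambda>c d. tsum R (\<lambda>c' d'.
        tsum (nu h) (\<lambda>u z. \<phi> (u * (d * g2 * d')) (S g1 * z * (S c * g3 * c')))))))"
    by (subst nu_central[of "\<lambda>u z. \<phi> (u * _) (z * _)"]) (simp_all add: m)
  also have "\<dots> = tsum (Delta g) (\<lambda>x g3. tsum (Delta x) (\<lambda>g1 g2. tsum R (\<lambda>c d. tsum R (\<lambda>c' d'.
        tsum (Delta h) (\<lambda>y h3. tsum (Delta y) (\<lambda>h1 h2. tsum R (\<lambda>a b. tsum R (\<lambda>a' b'.
          \<phi> (b * h2 * b' * (d * g2 * d')) (S g1 * (S h1 * S a * h3 * a') * (S c * g3 * c'))))))))))"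
    by (simp only: nu_expand[of h])
  also have "\<dots> = tsum (Delta g) (\<lambda>x g3. tsum (Delta x) (\<lambda>g1 g2.
        tsum (Delta h) (\<lambda>y h3. tsum (Delta y) (\<lambda>h1 h2. tsum R (\<lambda>a b. tsum R (\<lambda>c' d'. tsum R (\<lambda>a' b'. tsum R (\<lambda>c d.
          \<phi> (b * h2 * b' * (d * g2 * d')) (S g1 * (S h1 * S a * h3 * a') * (S c * g3 * c'))))))))))"
    by (simp only: Delta_R_swap) (subst tsum_permute4[of R R R R], rule refl)
  \<comment> \<open>With these two sums innermost, \<open>a' * S c\<close> and \<open>b' * d\<close>
    are adjacent and cancel by \<open>R_inverse\<close>.\<close>
  also have "\<dots> = tsum (Delta g) (\<lambda>x g3. tsum (Delta x) (\<lambda>g1 g2.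
        tsum (Delta h) (\<lambda>y h3. tsum (Delta y) (\<lambda>h1 h2. tsum R (\<lambda>a b. tsum R (\<lambda>c' d'.
          \<phi> (b * h2 * (g2 * d')) (S g1 * (S h1 * S a * h3) * (g3 * c'))))))))"
  proof -
    have "tsum R (\<lambda>a' b'. tsum R (\<lambda>c d.
          \<phi> (b * h2 * b' * (d * g2 * d')) (S g1 * (S h1 * S a * h3 * a') * (S c * g3 * c'))))
       = \<phi> (b * h2 * (g2 * d')) (S g1 * (S h1 * S a * h3) * (g3 * c'))" for a b c' d' g1 g2 g3 h1 h2 h3
      using R_inverse(2)[of "\<lambda>p q. \<phi> (b * h2 * q * (g2 * d')) (S g1 * (S h1 * S a * h3) * p * (g3 * c'))"]
      by (simp add: m)
    then show ?thesis by simp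
  qed
  also have "\<dots> = tsum (Delta h) (\<lambda>y h3. tsum (Delta g) (\<lambda>x g3. tsum (Delta x) (\<lambda>g1 g2. tsum (Delta y) (\<lambda>h1 h2.
        tsum R (\<lambda>a b. tsum R (\<lambda>c' d'. \<phi> (b * (h2 * g2) * d') (S (h1 * g1) * S a * (h3 * g3) * c')))))))"
    by (simp only: tsum_swap[of "Delta _" "Delta h"]) (simp only: S_mult mult.assoc)
  also have "\<dots> = tsum (Delta h) (\<lambda>y h3. tsum (Delta g) (\<lambda>x g3. tsum (Delta y) (\<lambda>h1 h2. tsum (Delta x) (\<lambda>g1 g2.
        tsum R (\<lambda>a b. tsum R (\<lambda>c' d'. \<phi> (b * (h2 * g2) * d') (S (h1 * g1) * S a * (h3 * g3) * c')))))))"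
    by (intro tsum_cong, rule tsum_swap)
  also have "\<dots> = tsum (nu (h * g)) \<phi>"
    by (simp add: nu_expand Delta_mult m)
  finally show ?thesis by simp
qed

text \<open>Axiom (2) splits both copies of \<open>R\<close> along the coproduct of the first leg,
  giving four copies in all. The product of two values of \<open>nu\<close> also contains four;
  centrality nests them in the same order, and \<open>h3 * S h4\<close> between them
  cancels.\<close>

lemma nu_Delta:
  assumes "tf \<phi>"
  shows "tsum (nu h) (\<lambda>u z. tsum (Delta u) (\<lambda>u1 u2. \<phi> u1 u2 z))
    = tsum (Delta h) (\<lambda>h1 h2. tsum (nu h1) (\<lambda>u z. tsum (nu h2) (\<lambda>v w. \<phi> u v (z * w))))"
proof -
  note m = mlin assms[unfolded form_defs]
  \<comment> \<open>The slot \<open>k\<close> holds what stands between \<open>S a\<close> and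
    \<open>S c\<close>: it is \<open>1\<close> on the left-hand side and \<open>h3 * S h4\<close> on
    the right.\<close>
  let ?G = "\<lambda>h1 h2 k h3 h4. tsum R (\<lambda>c d. tsum R (\<lambda>a b. tsum R (\<lambda>c' d'. tsum R (\<lambda>a' b'.
      \<phi> (b * h2 * b') (d * h3 * d') (S h1 * (S a * (k * (S c * (h4 * (c' * a'))))))))))"
  have 1: "tsum R (\<lambda>a b. tsum R (\<lambda>a' b'. tsum (Delta (b * y * b')) (\<lambda>u1 u2. \<phi> u1 u2 (S h1 * S a * h4 * a'))))
     = tsum (Delta y) (\<lambda>h2 h3. ?G h1 h2 1 h3 h4)" for h1 y h4
  proof -
    have "tsum R (\<lambda>a b. tsum R (\<lambda>a' b'. tsum (Delta (b * y * b')) (\<lambda>u1 u2. \<phi> u1 u2 (S h1 * S a * h4 * a'))))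
      = tsum R (\<lambda>a b. tsum R (\<lambda>a' b'. tsum (Delta b) (\<lambda>b1 b2. tsum (Delta y) (\<lambda>h2 h3. tsum (Delta b') (\<lambda>c1 c2.
          \<phi> (b1 * h2 * c1) (b2 * h3 * c2) (S h1 * S a * h4 * a'))))))"
      by (simp add: Delta_mult m)
    also have "\<dots> = tsum R (\<lambda>a b. tsum (Delta b) (\<lambda>b1 b2. tsum (Delta y) (\<lambda>h2 h3. tsum R (\<lambda>a' b'. tsum (Delta b') (\<lambda>c1 c2.
          \<phi> (b1 * h2 * c1) (b2 * h3 * c2) (S h1 * S a * h4 * a'))))))"
      by (simp only: Delta_R_swap)
    also have "\<dots> = tsum R (\<lambda>a b. tsum (Delta b) (\<lambda>b1 b2. tsum (Delta y) (\<lambda>h2 h3. tsum R (\<lambda>a' b'. tsum R (\<lambda>c' d'.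
          \<phi> (b1 * h2 * d') (b2 * h3 * b') (S h1 * S a * h4 * (a' * c')))))))"
      by (rule tsum_cong, rule tsum_cong, rule tsum_cong, rule R_2) (simp add: m)
    also have "\<dots> = tsum R (\<lambda>a b. tsum R (\<lambda>c d. tsum (Delta y) (\<lambda>h2 h3. tsum R (\<lambda>a' b'. tsum R (\<lambda>c' d'.
          \<phi> (d * h2 * d') (b * h3 * b') (S h1 * S (a * c) * h4 * (a' * c')))))))"
      by (rule R_2) (simp add: m)
    also have "\<dots> = tsum (Delta y) (\<lambda>h2 h3. tsum R (\<lambda>a b. tsum R (\<lambda>c d. tsum R (\<lambda>a' b'. tsum R (\<lambda>c' d'.
          \<phi> (d * h2 * d') (b * h3 * b') (S h1 * S (a * c) * h4 * (a' * c')))))))"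
      by (simp only: Delta_R_swap)
    finally show ?thesis by (simp add: S_mult mult.assoc)
  qed
  have "tsum (nu h) (\<lambda>u z. tsum (Delta u) (\<lambda>u1 u2. \<phi> u1 u2 z))
     = tsum (Delta h) (\<lambda>x h4. tsum (Delta x) (\<lambda>h1 y. tsum (Delta y) (\<lambda>h2 h3. ?G h1 h2 1 h3 h4)))"
    by (simp only: nu_expand 1)
  also have "\<dots> = tsum (Delta h) (\<lambda>x h4. tsum (Delta x) (\<lambda>y h3. tsum (Delta y) (\<lambda>h1 h2. ?G h1 h2 1 h3 h4)))"
    by (rule tsum_cong, rule coassoc[symmetric]) (simp add: m)
  also have "\<dots> = tsum (Delta h) (\<lambda>y t. tsum (Delta t) (\<lambda>h3 h4. tsum (Delta y) (\<lambda>h1 h2. ?G h1 h2 1 h3 h4)))"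
    by (rule coassoc) (simp add: m)
  also have "\<dots> = tsum (Delta h) (\<lambda>y t. tsum (Delta y) (\<lambda>h1 h2. tsum (Delta t) (\<lambda>h3 h4. ?G h1 h2 1 h3 h4)))"
    by (rule tsum_cong, rule tsum_swap)
  finally have left: "tsum (nu h) (\<lambda>u z. tsum (Delta u) (\<lambda>u1 u2. \<phi> u1 u2 z))
     = tsum (Delta h) (\<lambda>y t. tsum (Delta y) (\<lambda>h1 h2. tsum (Delta t) (\<lambda>h3 h4. ?G h1 h2 1 h3 h4)))" .
  \<comment> \<open>Centrality of \<open>w\<close> moves \<open>a'\<close> to the far right, so that
    \<open>h3\<close> comes to stand directly before the second value of \<open>nu\<close>.\<close>
  have 2: "tsum (nu q) (\<lambda>v w. \<phi> (b * h2 * b') v (S h1 * S a * h3 * a' * w))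
     = tsum (nu q) (\<lambda>v w. \<phi> (b * h2 * b') v (S h1 * S a * h3 * (w * a')))" for q h1 h2 h3 a b a' b'
    using nu_central[of "\<lambda>v w. \<phi> (b * h2 * b') v (S h1 * S a * h3 * w)" q a'] by (simp add: m)
  have 3: "tsum R (\<lambda>a b. tsum R (\<lambda>a' b'. tsum R (\<lambda>c d. tsum R (\<lambda>c' d'.
      \<phi> (b * h2 * b') (d * h5 * d') (S h1 * S a * h3 * (S h4 * S c * h6 * c' * a'))))))
     = ?G h1 h2 (h3 * S h4) h5 h6" for h1 h2 h3 h4 h5 h6
    by (subst tsum_permute4') (simp only: mult.assoc)
  have 4: "tsum (Delta t) (\<lambda>h3 q. tsum (Delta x) (\<lambda>h1 h2. tsum (Delta q) (\<lambda>y h6. tsum (Delta y) (\<lambda>h4 h5.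
       ?G h1 h2 (h3 * S h4) h5 h6))))
     = tsum (Delta x) (\<lambda>h1 h2. tsum (Delta t) (\<lambda>h3 h4. ?G h1 h2 1 h3 h4))" for t x
  proof -
    have "tsum (Delta t) (\<lambda>h3 q. tsum (Delta x) (\<lambda>h1 h2. tsum (Delta q) (\<lambda>y h6. tsum (Delta y) (\<lambda>h4 h5.
       ?G h1 h2 (h3 * S h4) h5 h6))))
      = tsum (Delta x) (\<lambda>h1 h2. tsum (Delta t) (\<lambda>h3 q. tsum (Delta q) (\<lambda>y h6. tsum (Delta y) (\<lambda>h4 h5.
       ?G h1 h2 (h3 * S h4) h5 h6))))"
      by (rule tsum_swap)
    also have "\<dots> = tsum (Delta x) (\<lambda>h1 h2. tsum (Delta t) (\<lambda>h3 q. tsum (Delta q) (\<lambda>h4 r. tsum (Delta r) (\<lambda>h5 h6.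
       ?G h1 h2 (h3 * S h4) h5 h6))))"
      by (rule tsum_cong, rule tsum_cong, rule coassoc) (simp add: m)
    also have "\<dots> = tsum (Delta x) (\<lambda>h1 h2. tsum (Delta t) (\<lambda>h3 h4. ?G h1 h2 1 h3 h4))"
      by (rule tsum_cong, rule cancel_S_left(2)[of "\<lambda>k r. tsum (Delta r) (\<lambda>h5 h6. ?G _ _ k h5 h6)"]) (simp add: m)
    finally show ?thesis .
  qed
  have "tsum (Delta h) (\<lambda>h1 h2. tsum (nu h1) (\<lambda>u z. tsum (nu h2) (\<lambda>v w. \<phi> u v (z * w))))
    = tsum (Delta h) (\<lambda>p q. tsum (Delta p) (\<lambda>x h3. tsum (Delta x) (\<lambda>h1 h2. tsum R (\<lambda>a b. tsum R (\<lambda>a' b'.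
       tsum (nu q) (\<lambda>v w. \<phi> (b * h2 * b') v (S h1 * S a * h3 * a' * w)))))))"
    by (rule tsum_cong, rule nu_expand)
  also have "\<dots> = tsum (Delta h) (\<lambda>p q. tsum (Delta p) (\<lambda>x h3. tsum (Delta x) (\<lambda>h1 h2. tsum (Delta q) (\<lambda>y h6. tsum (Delta y) (\<lambda>h4 h5.
      ?G h1 h2 (h3 * S h4) h5 h6)))))"
    by (simp only: 2 nu_expand Delta_R_swap 3)
  also have "\<dots> = tsum (Delta h) (\<lambda>x t. tsum (Delta t) (\<lambda>h3 q. tsum (Delta x) (\<lambda>h1 h2. tsum (Delta q) (\<lambda>y h6. tsum (Delta y) (\<lambda>h4 h5.
      ?G h1 h2 (h3 * S h4) h5 h6)))))"
    by (rule coassoc) (simp add: m)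
  also have "\<dots> = tsum (Delta h) (\<lambda>y t. tsum (Delta y) (\<lambda>h1 h2. tsum (Delta t) (\<lambda>h3 h4. ?G h1 h2 1 h3 h4)))"
    by (simp only: 4)
  finally show ?thesis using left by simp
qed

text \<open>The second legs of \<open>R\<close> are coinvariant under \<open>nu\<close>. Three legs
  of \<open>b\<close> occur but axiom (3) handles two, so axiom (2) first splits one leg off into a
  separate copy of \<open>R\<close>.\<close>

lemma nu_R:
  assumes "tf \<phi>"
  shows "tsum R (\<lambda>a b. tsum (nu b) (\<lambda>v w. \<phi> v w a)) = tsum R (\<lambda>a b. \<phi> b 1 a)"
proof -
  note m = mlin assms[unfolded form_defs]
  have swap: "tsum R (\<lambda>a b. tsum (Delta b) (\<lambda>b1 b2. tsum R (\<lambda>c d. F a b1 b2 c d)))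
     = tsum R (\<lambda>c d. tsum R (\<lambda>a b. tsum (Delta b) (\<lambda>b1 b2. F a b1 b2 c d)))"
    for F :: "'h \<Rightarrow> 'h \<Rightarrow> 'h \<Rightarrow> 'h \<Rightarrow> 'h \<Rightarrow> 'k"
    by (subst (2) tsum_swap) (rule tsum_cong, rule tsum_swap)
  have "tsum R (\<lambda>a b. tsum (nu b) (\<lambda>v w. \<phi> v w a))
     = tsum R (\<lambda>a b. tsum (Delta b) (\<lambda>f t. tsum (Delta t) (\<lambda>b2 b3. tsum R (\<lambda>c d. tsum R (\<lambda>c' d'.
          \<phi> (d * b2 * d') (S f * S c * b3 * c') a)))))"
    by (rule tsum_cong, rule nu_expand_right) (simp add: m)
  also have "\<dots> = tsum R (\<lambda>a b. tsum R (\<lambda>e f. tsum (Delta b) (\<lambda>b2 b3. tsum R (\<lambda>c d. tsum R (\<lambda>c' d'.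
          \<phi> (d * b2 * d') (S f * S c * b3 * c') (a * e))))))"
    by (rule R_2) (simp add: m)
  also have "\<dots> = tsum R (\<lambda>e f. tsum R (\<lambda>a b. tsum (Delta b) (\<lambda>b2 b3. tsum R (\<lambda>c d. tsum R (\<lambda>c' d'.
          \<phi> (d * b2 * d') (S f * S c * b3 * c') (a * e))))))"
    by (rule tsum_swap)
  also have "\<dots> = tsum R (\<lambda>e f. tsum R (\<lambda>c d. tsum R (\<lambda>a b. tsum (Delta b) (\<lambda>b2 b3. tsum R (\<lambda>c' d'.
          \<phi> (d * (b2 * d')) (S f * S c * (b3 * c')) (a * e))))))"
    unfolding mult.assoc by (rule tsum_cong, rule swap)
  \<comment> \<open>Axiom (3) carries \<open>c'\<close> and \<open>d'\<close> to the left of the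
    legs of \<open>b\<close>, next to \<open>S c\<close> and \<open>d\<close>, whose product with
    them is trivial by \<open>R_inverse\<close>.\<close>
  also have "\<dots> = tsum R (\<lambda>e f. tsum R (\<lambda>c d. tsum R (\<lambda>a b. tsum (Delta b) (\<lambda>b2 b3. tsum R (\<lambda>c' d'.
          \<phi> (d * (d' * b3)) (S f * S c * (c' * b2)) (a * e))))))"
    by (rule tsum_cong, rule tsum_cong, rule R_3[of "\<lambda>a p q. \<phi> (_ * q) (S _ * S _ * p) (a * _)"]) (simp add: m)
  also have "\<dots> = tsum R (\<lambda>e f. tsum R (\<lambda>a b. tsum (Delta b) (\<lambda>b2 b3. tsum R (\<lambda>c d. tsum R (\<lambda>c' d'.
          \<phi> (d * (d' * b3)) (S f * S c * (c' * b2)) (a * e))))))"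
    by (rule tsum_cong, rule swap[symmetric])
  also have "\<dots> = tsum R (\<lambda>e f. tsum R (\<lambda>a b. tsum (Delta b) (\<lambda>b2 b3. \<phi> b3 (S f * b2) (a * e))))"
  proof -
    have "tsum R (\<lambda>c d. tsum R (\<lambda>c' d'. \<phi> (d * (d' * b3)) (S f * S c * (c' * b2)) (a * e))) = \<phi> b3 (S f * b2) (a * e)"
      for a e f b2 b3
      using R_inverse(1)[of "\<lambda>p q. \<phi> (q * b3) (S f * p * b2) (a * e)"] by (simp add: m)
    then show ?thesis by simp
  qed
  also have "\<dots> = tsum R (\<lambda>a b. tsum R (\<lambda>e f. tsum (Delta b) (\<lambda>b2 b3. \<phi> b3 (S f * b2) (a * e))))"
    by (rule tsum_swap)
  also have "\<dots> = tsum R (\<lambda>a b. tsum (Delta b) (\<lambda>f t. tsum (Delta t) (\<lambda>b2 b3. \<phi> b3 (S f * b2) a)))"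
    by (rule R_2[symmetric]) (simp add: m)
  also have "\<dots> = tsum R (\<lambda>a b. \<phi> b 1 a)"
    by (rule tsum_cong, rule cancel_S_left(1)[of "\<lambda>k r. \<phi> r k _"]) (simp add: m)
  finally show ?thesis .
qed

text \<open>On the left, multiplicativity and \<open>nu_R\<close> leave \<open>nu\<close> of the
  middle leg only, so two conjugations are nested. On the right, axiom (1) splits the first legs of
  \<open>R\<close> and doubles each copy. Both sides are the same expression in five legs of
  \<open>h\<close>.\<close>

lemma nu_coassoc:
  assumes "tf \<phi>"
  shows "tsum (nu h) (\<lambda>u z. tsum (nu u) (\<lambda>v w. \<phi> v w z)) = tsum (nu h) (\<lambda>u z. tsum (Delta z) (\<lambda>z1 z2. \<phi> u z1 z2))"
proof -
  note m = mlin assms[unfolded form_defs]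
  \<comment> \<open>Read from the left-hand side, the copies \<open>(a, b)\<close> and
    \<open>(c', d')\<close> belong to the outer \<open>nu\<close>, and \<open>(c, d)\<close> and
    \<open>(a', b')\<close> to the inner one.\<close>
  let ?G = "\<lambda>s0 s1 s2 s3 s4. tsum R (\<lambda>a b. tsum R (\<lambda>c d. tsum R (\<lambda>a' b'. tsum R (\<lambda>c' d'.
      \<phi> (b * d * s2 * (b' * d')) (S s1 * S c * s3 * a') (S s0 * S a * s4 * c')))))"
  have 1: "tsum R (\<lambda>a b. tsum R (\<lambda>a' b'. tsum (nu (b * y * b')) (\<lambda>v w. \<phi> v w (S s0 * S a * s4 * a'))))
     = tsum (Delta y) (\<lambda>t s3. tsum (Delta t) (\<lambda>s1 s2. ?G s0 s1 s2 s3 s4))" for s0 y s4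
  proof -
    have "tsum R (\<lambda>a b. tsum R (\<lambda>a' b'. tsum (nu (b * y * b')) (\<lambda>v w. \<phi> v w (S s0 * S a * s4 * a'))))
      = tsum R (\<lambda>a b. tsum R (\<lambda>a' b'. tsum (nu b) (\<lambda>v1 w1. tsum (nu y) (\<lambda>v w. tsum (nu b') (\<lambda>v2 w2.
          \<phi> (v1 * v * v2) (w1 * w * w2) (S s0 * S a * s4 * a'))))))"
      by (simp add: nu_mult m)
    also have "\<dots> = tsum R (\<lambda>a b. tsum (nu b) (\<lambda>v1 w1. tsum (nu y) (\<lambda>v w. tsum R (\<lambda>a' b'. tsum (nu b') (\<lambda>v2 w2.
          \<phi> (v1 * v * v2) (w1 * w * w2) (S s0 * S a * s4 * a'))))))"
      by (simp only: tsum_swap[of R "nu _"])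
    also have "\<dots> = tsum R (\<lambda>a b. tsum (nu b) (\<lambda>v1 w1. tsum (nu y) (\<lambda>v w. tsum R (\<lambda>a' b'.
          \<phi> (v1 * v * b') (w1 * w * 1) (S s0 * S a * s4 * a')))))"
      by (rule tsum_cong, rule tsum_cong, rule tsum_cong,
          rule nu_R[of "\<lambda>v2 w2 a'. \<phi> (_ * _ * v2) (_ * _ * w2) (S s0 * S _ * s4 * a')"]) (simp add: m)
    also have "\<dots> = tsum R (\<lambda>a b. tsum (nu y) (\<lambda>v w. tsum R (\<lambda>a' b'.
          \<phi> (b * v * b') (1 * w * 1) (S s0 * S a * s4 * a'))))"
      by (rule nu_R) (simp add: m)
    also have "\<dots> = tsum (nu y) (\<lambda>v w. tsum R (\<lambda>a b. tsum R (\<lambda>a' b'. \<phi> (b * v * b') w (S s0 * S a * s4 * a'))))"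
      by (subst tsum_swap) simp
    also have "\<dots> = tsum (Delta y) (\<lambda>t s3. tsum (Delta t) (\<lambda>s1 s2. tsum R (\<lambda>c d. tsum R (\<lambda>a' b'. tsum R (\<lambda>a b. tsum R (\<lambda>c' d'.
         \<phi> (b * (d * s2 * b') * d') (S s1 * S c * s3 * a') (S s0 * S a * s4 * c')))))))"
      by (simp only: nu_expand)
    also have "\<dots> = tsum (Delta y) (\<lambda>t s3. tsum (Delta t) (\<lambda>s1 s2. ?G s0 s1 s2 s3 s4))"
    proof (rule tsum_cong, rule tsum_cong)
      fix s1 s2 s3
      have "tsum R (\<lambda>c d. tsum R (\<lambda>a' b'. tsum R (\<lambda>a b. tsum R (\<lambda>c' d'.
           \<phi> (b * (d * s2 * b') * d') (S s1 * S c * s3 * a') (S s0 * S a * s4 * c')))))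
         = tsum R (\<lambda>c d. tsum R (\<lambda>a b. tsum R (\<lambda>a' b'. tsum R (\<lambda>c' d'.
           \<phi> (b * (d * s2 * b') * d') (S s1 * S c * s3 * a') (S s0 * S a * s4 * c')))))"
        by (rule tsum_cong, rule tsum_swap)
      also have "\<dots> = ?G s0 s1 s2 s3 s4"
        by (subst tsum_swap) (simp only: mult.assoc)
      finally show "tsum R (\<lambda>c d. tsum R (\<lambda>a' b'. tsum R (\<lambda>a b. tsum R (\<lambda>c' d'.
           \<phi> (b * (d * s2 * b') * d') (S s1 * S c * s3 * a') (S s0 * S a * s4 * c')))))
         = ?G s0 s1 s2 s3 s4" .
    qed
    finally show ?thesis .
  qed
  \<comment> \<open>The antipode reverses the coproduct, so \<open>s0\<close> and \<open>a1\<close>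
    fall into the last leg, matching the outer \<open>nu\<close> on the other side.\<close>
  have 2: "tsum R (\<lambda>a b. tsum R (\<lambda>a' b'. tsum (Delta (S h1 * S a * h3 * a')) (\<lambda>z1 z2. \<phi> (b * h2 * b') z1 z2)))
     = tsum (Delta h1) (\<lambda>s0 s1. tsum (Delta h3) (\<lambda>s3 s4. ?G s0 s1 h2 s3 s4))" for h1 h2 h3
  proof -
    have "tsum R (\<lambda>a b. tsum R (\<lambda>a' b'. tsum (Delta (S h1 * S a * h3 * a')) (\<lambda>z1 z2. \<phi> (b * h2 * b') z1 z2)))
      = tsum R (\<lambda>a b. tsum R (\<lambda>a' b'. tsum (Delta h1) (\<lambda>s0 s1. tsum (Delta a) (\<lambda>a1 a2. tsum (Delta h3) (\<lambda>s3 s4.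
          tsum (Delta a') (\<lambda>c1 c2. \<phi> (b * h2 * b') (S s1 * S a2 * s3 * c1) (S s0 * S a1 * s4 * c2)))))))"
      by (simp add: Delta_mult Delta_S m)
    also have "\<dots> = tsum (Delta h1) (\<lambda>s0 s1. tsum R (\<lambda>a b. tsum (Delta a) (\<lambda>a1 a2. tsum (Delta h3) (\<lambda>s3 s4. tsum R (\<lambda>a' b'.
          tsum (Delta a') (\<lambda>c1 c2. \<phi> (b * h2 * b') (S s1 * S a2 * s3 * c1) (S s0 * S a1 * s4 * c2)))))))"
      by (simp only: Delta_R_swap)
    also have "\<dots> = tsum (Delta h1) (\<lambda>s0 s1. tsum R (\<lambda>a b. tsum (Delta a) (\<lambda>a1 a2. tsum (Delta h3) (\<lambda>s3 s4. tsum R (\<lambda>a' b'.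
          tsum R (\<lambda>c' d'. \<phi> (b * h2 * (b' * d')) (S s1 * S a2 * s3 * a') (S s0 * S a1 * s4 * c')))))))"
      by (rule tsum_cong, rule tsum_cong, rule tsum_cong, rule tsum_cong,
          rule R_1[of "\<lambda>c1 c2 b'. \<phi> (_ * h2 * b') (S _ * S _ * _ * c1) (S _ * S _ * _ * c2)"]) (simp add: m)
    also have "\<dots> = tsum (Delta h1) (\<lambda>s0 s1. tsum R (\<lambda>a b. tsum R (\<lambda>c d. tsum (Delta h3) (\<lambda>s3 s4. tsum R (\<lambda>a' b'.
          tsum R (\<lambda>c' d'. \<phi> (b * d * h2 * (b' * d')) (S s1 * S c * s3 * a') (S s0 * S a * s4 * c')))))))"
      by (rule tsum_cong, rule R_1) (simp add: m)
    also have "\<dots> = tsum (Delta h1) (\<lambda>s0 s1. tsum (Delta h3) (\<lambda>s3 s4. ?G s0 s1 h2 s3 s4))"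
      by (simp only: Delta_R_swap)
    finally show ?thesis .
  qed
  have "tsum (nu h) (\<lambda>u z. tsum (nu u) (\<lambda>v w. \<phi> v w z))
     = tsum (Delta h) (\<lambda>x s4. tsum (Delta x) (\<lambda>s0 y. tsum (Delta y) (\<lambda>t s3. tsum (Delta t) (\<lambda>s1 s2. ?G s0 s1 s2 s3 s4))))"
    by (subst nu_expand) (simp only: 1)
  \<comment> \<open>From here the five legs are only rebracketed: \<open>s0\<close> and
    \<open>s1\<close> become the coproduct of \<open>h1\<close>, \<open>s3\<close> and
    \<open>s4\<close> that of \<open>h3\<close>.\<close>
  also have "\<dots> = tsum (Delta h) (\<lambda>w s4. tsum (Delta w) (\<lambda>x s3. tsum (Delta x) (\<lambda>s0 t. tsum (Delta t) (\<lambda>s1 s2. ?G s0 s1 s2 s3 s4))))"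
    by (rule tsum_cong, rule coassoc[symmetric]) (simp add: m)
  also have "\<dots> = tsum (Delta h) (\<lambda>x r. tsum (Delta r) (\<lambda>s3 s4. tsum (Delta x) (\<lambda>s0 t. tsum (Delta t) (\<lambda>s1 s2. ?G s0 s1 s2 s3 s4))))"
    by (rule coassoc) (simp add: m)
  also have "\<dots> = tsum (Delta h) (\<lambda>x r. tsum (Delta r) (\<lambda>s3 s4. tsum (Delta x) (\<lambda>h1 s2. tsum (Delta h1) (\<lambda>s0 s1. ?G s0 s1 s2 s3 s4))))"
    by (rule tsum_cong, rule tsum_cong, rule coassoc[symmetric]) (simp add: m)
  also have "\<dots> = tsum (Delta h) (\<lambda>x h3. tsum (Delta x) (\<lambda>h1 h2. tsum (Delta h3) (\<lambda>s3 s4. tsum (Delta h1) (\<lambda>s0 s1. ?G s0 s1 h2 s3 s4))))"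
    by (rule tsum_cong, rule tsum_swap)
  also have "\<dots> = tsum (Delta h) (\<lambda>x h3. tsum (Delta x) (\<lambda>h1 h2. tsum (Delta h1) (\<lambda>s0 s1. tsum (Delta h3) (\<lambda>s3 s4. ?G s0 s1 h2 s3 s4))))"
    by (rule tsum_cong, rule tsum_cong, rule tsum_swap)
  also have "\<dots> = tsum (nu h) (\<lambda>u z. tsum (Delta z) (\<lambda>z1 z2. \<phi> u z1 z2))"
    by (simp only: nu_expand 2)
  finally show ?thesis .
qed

text \<open>Both sides are convolution inverse to \<open>nu\<close>.\<close>

lemma nu_S:
  assumes "bf \<phi>"
  shows "tsum (nu (S h)) \<phi> = tsum (nu h) (\<lambda>u z. \<phi> (S u) z)"
proof -
  note m = mlin assms[unfolded form_defs]
  let ?F = "\<lambda>u z v w v' w'. \<phi> (u * v * S v') (z * (w * w'))"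
  let ?X = "tsum (Delta h) (\<lambda>h1 x. tsum (Delta x) (\<lambda>h2 h3. tsum (nu (S h1)) (\<lambda>u z. tsum (nu h2) (\<lambda>v w.
      tsum (nu h3) (\<lambda>v' w'. ?F u z v w v' w')))))"
  \<comment> \<open>\<open>nu_Delta\<close> merges the two values of \<open>nu\<close> into one
    whose first leg is expanded as \<open>p * S q\<close>; the antipode reduces it to a counit,
    which \<open>nu_counit_left\<close> evaluates.\<close>
  have 1: "tsum (Delta x) (\<lambda>h2 h3. tsum (nu h2) (\<lambda>v w. tsum (nu h3) (\<lambda>v' w'. ?F u z v w v' w')))
      = eps x * \<phi> u z" for x u z
  proof -
    have "tsum (Delta x) (\<lambda>h2 h3. tsum (nu h2) (\<lambda>v w. tsum (nu h3) (\<lambda>v' w'. ?F u z v w v' w')))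
       = tsum (nu x) (\<lambda>t r. tsum (Delta t) (\<lambda>p q. \<phi> (u * p * S q) (z * r)))"
      by (rule nu_Delta[symmetric, of "\<lambda>p q r. \<phi> (u * p * S q) (z * r)"]) (simp add: m)
    also have "\<dots> = tsum (nu x) (\<lambda>t r. eps t * \<phi> u (z * r))"
      using antipode_right[of "\<lambda>k. \<phi> (u * k) _"] by (simp add: m)
    also have "\<dots> = eps x * \<phi> u z"
      by (subst nu_counit_left) (simp_all add: m)
    finally show ?thesis .
  qed
  have "?X = tsum (Delta h) (\<lambda>h1 x. tsum (nu (S h1)) (\<lambda>u z. tsum (Delta x) (\<lambda>h2 h3. tsum (nu h2) (\<lambda>v w.
      tsum (nu h3) (\<lambda>v' w'. ?F u z v w v' w')))))"
    by (rule tsum_cong, rule tsum_swap)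
  also have "\<dots> = tsum (Delta h) (\<lambda>h1 x. eps x * tsum (nu (S h1)) \<phi>)"
    by (simp only: 1 tsum_scale)
  also have "\<dots> = tsum (nu (S h)) \<phi>"
    by (rule counit_right) (simp add: m)
  finally have 2: "?X = tsum (nu (S h)) \<phi>" .
  have "?X = tsum (Delta h) (\<lambda>x h3. tsum (Delta x) (\<lambda>h1 h2. tsum (nu (S h1)) (\<lambda>u z. tsum (nu h2) (\<lambda>v w.
      tsum (nu h3) (\<lambda>v' w'. ?F u z v w v' w')))))"
    by (rule coassoc[symmetric]) (simp add: m)
  also have "\<dots> = tsum (Delta h) (\<lambda>x h3. tsum (Delta x) (\<lambda>h1 h2. tsum (nu (S h1 * h2)) (\<lambda>p q.
      tsum (nu h3) (\<lambda>v' w'. \<phi> (p * S v') (q * w')))))"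
    by (subst nu_mult) (simp_all add: m)
  also have "\<dots> = tsum (Delta h) (\<lambda>x h3. eps x * tsum (nu 1) (\<lambda>p q.
      tsum (nu h3) (\<lambda>v' w'. \<phi> (p * S v') (q * w'))))"
    by (rule tsum_cong, rule antipode_left[of "\<lambda>t. tsum (nu t) (\<lambda>p q. tsum (nu _) (\<lambda>v' w'. \<phi> (p * S v') (q * w')))"])
      (simp add: m)
  also have "\<dots> = tsum (Delta h) (\<lambda>x h3. eps x * tsum (nu h3) (\<lambda>v w. \<phi> (S v) w))"
    by (subst nu_one) (simp_all add: m)
  also have "\<dots> = tsum (nu h) (\<lambda>u z. \<phi> (S u) z)"
    by (rule counit_left) (simp add: m)
  finally show ?thesis using 2 by simp
qed

text \<open>After \<open>nu_S\<close>, coassociativity turns the two second legs \<open>w\<close>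
  and \<open>z\<close> into the two legs of one coproduct, and \<open>z2 * Sinv z1\<close> is
  exactly the order in which \<open>Sinv\<close> cancels.\<close>

lemma nu_nu_S_cancel:
  assumes "bf \<phi>"
  shows "tsum (nu h) (\<lambda>x z. tsum (nu (S x)) (\<lambda>u w. \<phi> u (z * Sinv w))) = \<phi> (S h) 1"
proof -
  note m = mlin assms[unfolded form_defs]
  have "tsum (nu h) (\<lambda>x z. tsum (nu (S x)) (\<lambda>u w. \<phi> u (z * Sinv w)))
     = tsum (nu h) (\<lambda>x z. tsum (nu x) (\<lambda>u w. \<phi> (S u) (z * Sinv w)))"
    by (rule tsum_cong, rule nu_S) (simp add: m)
  also have "\<dots> = tsum (nu h) (\<lambda>u z. tsum (Delta z) (\<lambda>z1 z2. \<phi> (S u) (z2 * Sinv z1)))"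
    by (rule nu_coassoc) (simp add: m)
  also have "\<dots> = tsum (nu h) (\<lambda>u z. eps z * \<phi> (S u) 1)"
    by (rule tsum_cong, rule Sinv_antipode) (simp add: m)
  also have "\<dots> = \<phi> (S h) 1"
    by (rule nu_counit_right) (simp add: m)
  finally show ?thesis .
qed

end

section \<open>The dual module\<close>

text \<open>Proving an equality requires only products of functionals, whereas using one is allowed
  under every bilinear form.\<close>

lemma ten2_eqI:
  assumes "Vector_Spaces.vector_space sa" "Vector_Spaces.vector_space sb"
    and "\<And>f g. lform sa f \<Longrightarrow> lform sb g \<Longrightarrow> tsum xs (\<lambda>a b. f a * g b) = tsum ys (\<lambda>a b. f a * g b)"
  shows "ten2_eq sa sb xs ys"
  using assms by (simp add: ten2_eq_def tsum_def linear_functional_iff_lform)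

lemma ten3_eqI:
  assumes "Vector_Spaces.vector_space sa" "Vector_Spaces.vector_space sb" "Vector_Spaces.vector_space sc"
    and "\<And>f g h. lform sa f \<Longrightarrow> lform sb g \<Longrightarrow> lform sc h \<Longrightarrow>
      tsum3 xs (\<lambda>a b c. f a * g b * h c) = tsum3 ys (\<lambda>a b c. f a * g b * h c)"
  shows "ten3_eq sa sb sc xs ys"
  using assms by (simp add: ten3_eq_def tsum3_def linear_functional_iff_lform)

lemma sum_list_fun_apply: "sum_list (map f xs) x = sum_list (map (\<lambda>a. f a x) xs)"
  by (induction xs) (auto simp: zero_fun_def)

lemma vector_space_dual_scale: "Vector_Spaces.vector_space (dual_scale :: 'k::field \<Rightarrow> ('m \<Rightarrow> 'k) \<Rightarrow> 'm \<Rightarrow> 'k)"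
  by unfold_locales (auto simp: dual_scale_def fun_eq_iff algebra_simps)

locale normal_hopf_module = sqt_hopf sH Delta eps S R
  for sH :: "'k::field \<Rightarrow> 'h::ring_1 \<Rightarrow> 'h"
    and Delta :: "'h \<Rightarrow> ('h \<times> 'h) list" and eps :: "'h \<Rightarrow> 'k" and S :: "'h \<Rightarrow> 'h"
    and R :: "('h \<times> 'h) list" +
  fixes sM :: "'k \<Rightarrow> 'm::ab_group_add \<Rightarrow> 'm" and act :: "'h \<Rightarrow> 'm \<Rightarrow> 'm"
    and coact :: "'m \<Rightarrow> ('m \<times> 'h) list"
    and B :: "('m \<times> ('m \<Rightarrow> 'k)) list"
  assumes normal_module: "normal_module sH Delta eps S R sM UNIV act coact"
    and dual_bases: "dual_bases sM UNIV B"
begin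

section \<open>The module axioms under multilinear forms\<close>

lemma vector_space_M: "Vector_Spaces.vector_space sM"
  using normal_module by (simp add: normal_module_def)

lemma act_simps:
  "act (h + g) m = act h m + act g m" "act (sH c h) m = sM c (act h m)"
  "act h (m + n) = act h m + act h n" "act h (sM c m) = sM c (act h m)"
  "act (h * g) m = act h (act g m)" "act 1 m = m"
  using normal_module by (simp_all add: normal_module_def)

lemma coact_add:
  assumes "bform sM sH \<phi>"
  shows "tsum (coact (m + n)) \<phi> = tsum (coact m) \<phi> + tsum (coact n) \<phi>"
proof -
  have "ten2_eq sM sH (coact (m + n)) (coact m @ coact n)"
    using normal_module by (simp add: normal_module_def)
  with assms show ?thesis
    by (simp add: ten2_eq_iff_bform[OF vector_space_M vector_space_H] tsum_lists)
qed

lemma coact_scale: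
  assumes "bform sM sH \<phi>"
  shows "tsum (coact (sM c m)) \<phi> = c * tsum (coact m) \<phi>"
proof -
  have "ten2_eq sM sH (coact (sM c m)) (map (\<lambda>(a,b). (sM c a, b)) (coact m))"
    using normal_module by (simp add: normal_module_def)
  with assms have "tsum (coact (sM c m)) \<phi> = tsum (map (\<lambda>(a,b). (sM c a, b)) (coact m)) \<phi>"
    by (simp add: ten2_eq_iff_bform[OF vector_space_M vector_space_H])
  then show ?thesis
    using assms by (simp add: tsum_lists form_defs tsum_scale)
qed

lemmas mlinM = mlin act_simps(1-4) coact_add coact_scale

lemma coact_coassoc:
  assumes "tform sM sH sH \<phi>"
  shows "tsum (coact m) (\<lambda>m0 m1. tsum (coact m0) (\<lambda>m00 m01. \<phi> m00 m01 m1))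
    = tsum (coact m) (\<lambda>m0 m1. tsum (Delta m1) (\<lambda>c d. \<phi> m0 c d))"
proof -
  have "ten3_eq sM sH sH
        (concat (map (\<lambda>(m0,m1). map (\<lambda>(m00,m01). (m00,m01,m1)) (coact m0)) (coact m)))
        (concat (map (\<lambda>(m0,m1). map (\<lambda>(c,d). (m0,c,d)) (Delta m1)) (coact m)))"
    using normal_module by (simp add: normal_module_def)
  with assms show ?thesis
    by (simp add: ten3_eq_iff_tform[OF vector_space_M vector_space_H vector_space_H] tsum_lists case_prod_beta)
qed

lemma coact_counit:
  assumes "lform sM f"
  shows "tsum (coact m) (\<lambda>m0 m1. eps m1 * f m0) = f m"
proof -
  have "sum_list (map (\<lambda>(m0,m1). sM (eps m1) m0) (coact m)) = m"
    using normal_module by (simp add: normal_module_def)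
  then have "f m = tsum (coact m) (\<lambda>m0 m1. f (sM (eps m1) m0))"
    using lform_tsum[OF assms, of "\<lambda>m0 m1. sM (eps m1) m0" "coact m"] by simp
  then show ?thesis using assms by (simp add: lform_def)
qed

lemma coact_center:
  obtains ys where "\<And>\<phi>. bform sM sH \<phi> \<Longrightarrow> tsum (coact m) \<phi> = tsum ys \<phi>" "\<forall>p\<in>set ys. snd p \<in> center"
proof -
  have "\<exists>ys. ten2_eq sM sH (coact m) ys \<and> (\<forall>p\<in>set ys. snd p \<in> center)"
    using normal_module by (simp add: normal_module_def)
  then obtain ys where ys: "ten2_eq sM sH (coact m) ys" "\<forall>p\<in>set ys. snd p \<in> center"
    by (elim exE conjE)
  show thesis
  proof (rule that)
    show "tsum (coact m) \<phi> = tsum ys \<phi>" if "bform sM sH \<phi>" for \<phi>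
      using ys(1) that by (simp add: ten2_eq_iff_bform[OF vector_space_M vector_space_H])
  qed (rule ys(2))
qed

text \<open>The given coaction is replaced by a list with central entries, as for \<open>nu\<close>;
  \<open>Sinv\<close> keeps those entries central.\<close>

lemma coact_Sinv_central:
  assumes "bform sM sH \<phi>"
  shows "tsum (coact m) (\<lambda>m0 m1. \<phi> m0 (Sinv m1 * x)) = tsum (coact m) (\<lambda>m0 m1. \<phi> m0 (x * Sinv m1))"
proof -
  note m = mlinM assms[unfolded form_defs]
  obtain ys where ys: "\<And>\<phi>. bform sM sH \<phi> \<Longrightarrow> tsum (coact m) \<phi> = tsum ys \<phi>"
    and center: "\<forall>p\<in>set ys. snd p \<in> center"
    by (rule coact_center) (rule that)
  have "tsum (coact m) (\<lambda>m0 m1. \<phi> m0 (Sinv m1 * x)) = tsum ys (\<lambda>m0 m1. \<phi> m0 (Sinv m1 * x))"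
    by (rule ys) (simp add: m)
  also have "\<dots> = tsum ys (\<lambda>m0 m1. \<phi> m0 (x * Sinv m1))"
  proof (rule tsum_cong_set)
    fix m0 m1 assume "(m0, m1) \<in> set ys"
    then have "Sinv m1 \<in> center" using center Sinv_center by force
    then show "\<phi> m0 (Sinv m1 * x) = \<phi> m0 (x * Sinv m1)" by (simp add: center_def)
  qed
  also have "\<dots> = tsum (coact m) (\<lambda>m0 m1. \<phi> m0 (x * Sinv m1))"
    by (rule ys[symmetric]) (simp add: m)
  finally show ?thesis .
qed

text \<open>In terms of \<open>nu\<close>, condition (ii) says that the coaction is compatible with
  the action leg by leg; \<open>R\<close> no longer appears explicitly.\<close>

lemma coact_act:
  assumes "bform sM sH \<phi>"
  shows "tsum (coact (act h m)) \<phi> = tsum (nu h) (\<lambda>u z. tsum (coact m) (\<lambda>m0 m1. \<phi> (act u m0) (z * m1)))"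
proof -
  have "ten2_eq sM sH (coact (act h m))
        (concat (map (\<lambda>(h1,h2,h3). concat (map (\<lambda>(a,b). concat (map (\<lambda>(a',b').
            map (\<lambda>(m0,m1). (act (b * h2 * b') m0, S h1 * S a * h3 * a' * m1)) (coact m)) R)) R))
          (Delta2 Delta h)))"
    using normal_module unfolding normal_module_def by (elim conjE) (simp only: UNIV_I simp_thms)
  with assms show ?thesis
    by (simp add: ten2_eq_iff_bform[OF vector_space_M vector_space_H] tsum_lists case_prod_beta
        nu_expand Delta2_def)
qed

section \<open>Functionals on the dual and the dual coaction\<close>

abbreviation "dcoact \<equiv> dual_coact S coact B"

lemma mem_dual_space_iff: "f \<in> dual_space sM \<longleftrightarrow> lform sM f"
  by (simp add: dual_space_def linear_functional_iff_lform vector_space_M)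

lemma dual_basis_lform: "(mi, fi) \<in> set B \<Longrightarrow> lform sM fi"
  using dual_bases linear_functional_iff_lform[OF vector_space_M]
  by (fastforce simp: dual_bases_def in_set_conv_nth)

lemma dual_bases_expand: "sum_list (map (\<lambda>(mi, fi). sM (fi m) mi) B) = m"
  using dual_bases by (simp add: dual_bases_def)

text \<open>Since \<open>M\<close> is finite-dimensional, every functional on its dual is evaluation at a vector.\<close>

definition evaluation_point :: "(('m \<Rightarrow> 'k) \<Rightarrow> 'k) \<Rightarrow> 'm" where
  "evaluation_point F = sum_list (map (\<lambda>(mi, fi). sM (F fi) mi) B)"

lemma lform_evaluation_point:
  "lform sM f \<Longrightarrow> f (evaluation_point F) = tsum B (\<lambda>mi fi. F fi * f mi)"
  unfolding evaluation_point_def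
  by (subst lform_tsum[of sM]) (simp_all add: lform_def)

text \<open>\<open>F\<close> is a functional on all functions, but a linear \<open>f\<close> is the
  combination of the \<open>fi\<close> with coefficients \<open>f mi\<close>, so \<open>F f\<close>
  depends only on the values \<open>F fi\<close>.\<close>

lemma evaluation_point:
  assumes F: "lform dual_scale F" and f: "lform sM f"
  shows "F f = f (evaluation_point F)"
proof -
  have "f = sum_list (map (\<lambda>(mi, fi). dual_scale (f mi) fi) B)"
  proof
    fix x
    have "f x = f (sum_list (map (\<lambda>(mi, fi). sM (fi x) mi) B))"
      by (simp add: dual_bases_expand)
    also have "\<dots> = tsum B (\<lambda>mi fi. f mi * fi x)"
      using f by (subst lform_tsum[OF f]) (simp add: lform_def mult.commute)
    finally show "f x = sum_list (map (\<lambda>(mi, fi). dual_scale (f mi) fi) B) x"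
      by (simp add: sum_list_fun_apply tsum_def dual_scale_def case_prod_unfold)
  qed
  then have "F f = F (sum_list (map (\<lambda>(mi, fi). dual_scale (f mi) fi) B))"
    by (rule arg_cong)
  also have "\<dots> = tsum B (\<lambda>mi fi. F fi * f mi)"
    using F by (subst lform_tsum[OF F]) (simp add: lform_def mult.commute)
  finally show ?thesis by (simp add: lform_evaluation_point[OF f])
qed

lemma lform_evaluation: "lform dual_scale (\<lambda>f. f m)"
  by (simp add: lform_def dual_scale_def)

lemma evaluation_point_evaluation: "evaluation_point (\<lambda>f. f m) = m"
  by (simp add: evaluation_point_def dual_bases_expand)

lemma tsum_dcoact: "tsum (dcoact f) \<phi> = tsum B (\<lambda>mi fi. tsum (coact mi) (\<lambda>a b. \<phi> (dual_scale (f a) fi) (Sinv b)))"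
  by (simp add: dual_coact_def tsum_lists case_prod_beta)

text \<open>This eliminates the dual bases: the sum of the coactions of \<open>mi\<close> weighted
  by \<open>F fi\<close> is, by linearity, the coaction of a single vector.\<close>

lemma dcoact_eval:
  assumes f: "lform sM f" and F: "lform dual_scale F" and g: "lf g"
  shows "tsum (dcoact f) (\<lambda>f0 f1. F f0 * g f1)
    = tsum (coact (evaluation_point F)) (\<lambda>m0 m1. f m0 * g (Sinv m1))"
proof -
  have "tsum (dcoact f) (\<lambda>f0 f1. F f0 * g f1)
    = tsum B (\<lambda>mi fi. F fi * tsum (coact mi) (\<lambda>m0 m1. f m0 * g (Sinv m1)))"
    using F by (simp add: tsum_dcoact lform_def ac_simps flip: tsum_scale)
  also have "\<dots> = tsum (coact (evaluation_point F)) (\<lambda>m0 m1. f m0 * g (Sinv m1))"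
    by (rule lform_evaluation_point[symmetric])
      (simp add: mlinM f[unfolded lform_def] g[unfolded lform_def])
  finally show ?thesis .
qed

lemmas dcoact_eval_at = dcoact_eval[OF _ lform_evaluation, unfolded evaluation_point_evaluation]

lemma dcoact_lform:
  assumes "(f0, f1) \<in> set (dcoact f)"
  shows "lform sM f0"
  using assms dual_basis_lform
  by (fastforce simp: dual_coact_def lform_def dual_scale_def algebra_simps)

lemma dual_act_lform: "lform sM f \<Longrightarrow> lform sM (dual_act S act h f)"
  by (simp add: lform_def dual_act_def act_simps)

text \<open>Evaluation at \<open>n\<close> moves the action from functionals to \<open>n\<close>.
  Condition (ii) for the original module then produces \<open>nu (S x)\<close>, which
  \<open>nu_nu_S_cancel\<close> absorbs into the outer \<open>nu h\<close>.\<close>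

lemma dcoact_act:
  assumes f: "lform sM f"
  shows "ten2_eq dual_scale sH (dcoact (dual_act S act h f))
        (concat (map (\<lambda>(h1,h2,h3). concat (map (\<lambda>(a,b). concat (map (\<lambda>(a',b').
            map (\<lambda>(f0,f1). (dual_act S act (b * h2 * b') f0, S h1 * S a * h3 * a' * f1)) (dcoact f)) R)) R))
          (Delta2 Delta h)))" (is "ten2_eq _ _ ?xs ?ys")
proof (rule ten2_eqI[OF vector_space_dual_scale vector_space_H])
  fix F :: "('m \<Rightarrow> 'k) \<Rightarrow> 'k" and g
  assume F: "lform dual_scale F" and g: "lf g"
  define n where "n = evaluation_point F"
  note m = mlinM f[unfolded lform_def] g[unfolded lform_def]
  have 1: "tsum (dcoact f) (\<lambda>f0 f1. F (dual_act S act x f0) * g (z * f1))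
      = tsum (nu (S x)) (\<lambda>u w. tsum (coact n) (\<lambda>m0 m1. f (act u m0) * g (z * Sinv w * Sinv m1)))" for x z
  proof -
    have "tsum (dcoact f) (\<lambda>f0 f1. F (dual_act S act x f0) * g (z * f1))
      = tsum (dcoact f) (\<lambda>f0 f1. f0 (act (S x) n) * g (z * f1))"
    \<comment> \<open>Replacing \<open>F\<close> by evaluation at \<open>n\<close> is valid only on
      linear functionals, hence the appeal to membership in the dual coaction.\<close>
    proof (rule tsum_cong_set)
      fix f0 f1 assume "(f0, f1) \<in> set (dcoact f)"
      from evaluation_point[OF F dual_act_lform[OF dcoact_lform[OF this]]]
      show "F (dual_act S act x f0) * g (z * f1) = f0 (act (S x) n) * g (z * f1)"
        by (simp only: n_def dual_act_def)
    qed
    also have "\<dots> = tsum (coact (act (S x) n)) (\<lambda>m0 m1. f m0 * g (z * Sinv m1))"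
      by (rule dcoact_eval_at[OF f, of "\<lambda>u. g (z * u)"]) (simp add: m)
    also have "\<dots> = tsum (nu (S x)) (\<lambda>u w. tsum (coact n) (\<lambda>m0 m1. f (act u m0) * g (z * (Sinv m1 * Sinv w))))"
      by (subst coact_act) (simp_all add: m Sinv_mult)
    \<comment> \<open>\<open>Sinv\<close> has reversed the product; centrality restores the order in
      which \<open>Sinv w\<close> stands next to \<open>z\<close>.\<close>
    also have "\<dots> = tsum (nu (S x)) (\<lambda>u w. tsum (coact n) (\<lambda>m0 m1. f (act u m0) * g (z * (Sinv w * Sinv m1))))"
      by (rule tsum_cong, rule coact_Sinv_central[of "\<lambda>m0 k. f (act _ m0) * g (z * k)"]) (simp add: m)
    finally show ?thesis by (simp add: mult.assoc)
  qed
  have "tsum ?ys (\<lambda>f0 f1. F f0 * g f1)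
     = tsum (nu h) (\<lambda>x z. tsum (dcoact f) (\<lambda>f0 f1. F (dual_act S act x f0) * g (z * f1)))"
    by (simp add: nu_expand tsum_lists case_prod_beta Delta2_def)
  also have "\<dots> = tsum (coact n) (\<lambda>m0 m1. f (act (S h) m0) * g (1 * Sinv m1))"
    unfolding 1
    by (rule nu_nu_S_cancel[of "\<lambda>u k. tsum (coact n) (\<lambda>m0 m1. f (act u m0) * g (k * Sinv m1))"]) (simp add: m)
  also have "\<dots> = tsum ?xs (\<lambda>f0 f1. F f0 * g f1)"
    unfolding dcoact_eval[OF dual_act_lform[OF f] F g] by (simp add: n_def dual_act_def)
  finally show "tsum ?xs (\<lambda>f0 f1. F f0 * g f1) = tsum ?ys (\<lambda>f0 f1. F f0 * g f1)" by simp
qed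

text \<open>Two reversals compensate: dualising exchanges the inner and the outer coaction, and
  \<open>Sinv\<close> exchanges the legs of the coproduct.\<close>

lemma dcoact_coassoc:
  assumes f: "lform sM f"
  shows "ten3_eq dual_scale sH sH
        (concat (map (\<lambda>(f0,f1). map (\<lambda>(f00,f01). (f00,f01,f1)) (dcoact f0)) (dcoact f)))
        (concat (map (\<lambda>(f0,f1). map (\<lambda>(c,d). (f0,c,d)) (Delta f1)) (dcoact f)))"
    (is "ten3_eq _ _ _ ?xs ?ys")
proof (rule ten3_eqI[OF vector_space_dual_scale vector_space_H vector_space_H])
  fix F :: "('m \<Rightarrow> 'k) \<Rightarrow> 'k" and g g'
  assume F: "lform dual_scale F" and g: "lf g" and g': "lf g'"
  define n where "n = evaluation_point F"
  note m = mlinM f[unfolded lform_def] g[unfolded lform_def] g'[unfolded lform_def]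
  have "tsum3 ?xs (\<lambda>a b c. F a * g b * g' c)
     = tsum (dcoact f) (\<lambda>f0 f1. tsum (dcoact f0) (\<lambda>f00 f01. F f00 * g f01) * g' f1)"
    by (simp add: tsum_lists case_prod_beta tsum_scale_right)
  also have "\<dots> = tsum (dcoact f) (\<lambda>f0 f1. tsum (coact n) (\<lambda>m0 m1. f0 m0 * g (Sinv m1)) * g' f1)"
    by (rule tsum_cong_set) (simp add: dcoact_eval[OF dcoact_lform F g] n_def)
  also have "\<dots> = tsum (dcoact f) (\<lambda>f0 f1. tsum (coact n) (\<lambda>m0 m1. g (Sinv m1) * (f0 m0 * g' f1)))"
    by (simp add: ac_simps flip: tsum_scale)
  also have "\<dots> = tsum (coact n) (\<lambda>m0 m1. g (Sinv m1) * tsum (dcoact f) (\<lambda>f0 f1. f0 m0 * g' f1))"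
    by (subst tsum_swap) (simp add: tsum_scale)
  also have "\<dots> = tsum (coact n) (\<lambda>m0 m1. tsum (coact m0) (\<lambda>m00 m01. f m00 * g' (Sinv m01) * g (Sinv m1)))"
    by (simp add: dcoact_eval_at[OF f g'] mult.commute flip: tsum_scale)
  also have "\<dots> = tsum (coact n) (\<lambda>m0 m1. tsum (Delta m1) (\<lambda>c d. f m0 * g' (Sinv c) * g (Sinv d)))"
    by (rule coact_coassoc) (simp add: m)
  also have "\<dots> = tsum (coact n) (\<lambda>m0 m1. f m0 * tsum (Delta (Sinv m1)) (\<lambda>c d. g c * g' d))"
    by (subst Delta_Sinv) (simp_all add: m)
  also have "\<dots> = tsum (dcoact f) (\<lambda>f0 f1. F f0 * tsum (Delta f1) (\<lambda>c d. g c * g' d))"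
    unfolding n_def by (rule dcoact_eval[OF f F, symmetric]) (simp add: m)
  also have "\<dots> = tsum3 ?ys (\<lambda>a b c. F a * g b * g' c)"
    by (simp add: tsum_lists case_prod_beta mult.assoc tsum_scale)
  finally show "tsum3 ?xs (\<lambda>a b c. F a * g b * g' c) = tsum3 ?ys (\<lambda>a b c. F a * g b * g' c)" .
qed

lemma dcoact_counit:
  assumes f: "lform sM f"
  shows "sum_list (map (\<lambda>(f0,f1). dual_scale (eps f1) f0) (dcoact f)) = f"
proof
  fix x
  have "sum_list (map (\<lambda>(f0,f1). dual_scale (eps f1) f0) (dcoact f)) x
      = tsum (dcoact f) (\<lambda>f0 f1. f0 x * eps f1)"
    by (simp add: sum_list_fun_apply tsum_def dual_scale_def case_prod_unfold mult.commute)
  also have "\<dots> = tsum (coact x) (\<lambda>m0 m1. f m0 * eps (Sinv m1))"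
    by (rule dcoact_eval_at[OF f]) (simp add: lform_def eps_add eps_scale)
  also have "\<dots> = f x"
    using coact_counit[OF f, of x] by (simp add: eps_Sinv mult.commute)
  finally show "sum_list (map (\<lambda>(f0,f1). dual_scale (eps f1) f0) (dcoact f)) x = f x" .
qed

text \<open>Central representatives are chosen for the coaction of each vector and inserted into the
  formula for the dual coaction. The first entries are multiples of the \<open>fi\<close>, hence
  linear.\<close>

lemma dcoact_center:
  assumes f: "lform sM f"
  shows "\<exists>ys. ten2_eq dual_scale sH (dcoact f) ys \<and> (\<forall>p\<in>set ys. fst p \<in> dual_space sM \<and> snd p \<in> center)"
proof -
  have "\<exists>ys. (\<forall>\<phi>. bform sM sH \<phi> \<longrightarrow> tsum (coact m) \<phi> = tsum ys \<phi>) \<and> (\<forall>p\<in>set ys. snd p \<in> center)" for m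
    by (rule coact_center[of m]) blast
  then obtain Y where Y: "\<And>m \<phi>. bform sM sH \<phi> \<Longrightarrow> tsum (coact m) \<phi> = tsum (Y m) \<phi>"
    and center: "\<And>m p. p \<in> set (Y m) \<Longrightarrow> snd p \<in> center"
    by metis
  let ?ys = "concat (map (\<lambda>(mi, fi). map (\<lambda>(a,b). (dual_scale (f a) fi, Sinv b)) (Y mi)) B)"
  have "ten2_eq dual_scale sH (dcoact f) ?ys"
  proof (rule ten2_eqI[OF vector_space_dual_scale vector_space_H])
    fix F :: "('m \<Rightarrow> 'k) \<Rightarrow> 'k" and g
    assume F: "lform dual_scale F" and g: "lf g"
    have "tsum (coact mi) (\<lambda>a b. F (dual_scale (f a) fi) * g (Sinv b))
      = tsum (Y mi) (\<lambda>a b. F (dual_scale (f a) fi) * g (Sinv b))" for mi fi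
      by (rule Y) (use F in \<open>simp add: mlinM f[unfolded lform_def] g[unfolded lform_def]\<close>)
    then show "tsum (dcoact f) (\<lambda>a b. F a * g b) = tsum ?ys (\<lambda>a b. F a * g b)"
      by (simp add: tsum_dcoact tsum_lists case_prod_beta)
  qed
  moreover have "fst p \<in> dual_space sM \<and> snd p \<in> center" if p: "p \<in> set ?ys" for p
  proof -
    obtain mi fi a b where "(mi, fi) \<in> set B" "(a, b) \<in> set (Y mi)" "p = (dual_scale (f a) fi, Sinv b)"
      using p by auto
    with dual_basis_lform[of mi fi] center[of "(a, b)" mi] Sinv_center[of b] show ?thesis
      by (auto simp: mem_dual_space_iff lform_def dual_scale_def algebra_simps)
  qed
  ultimately show ?thesis by blast
qed

section \<open>The dual as a normal module\<close>

lemma normal_module_dual: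
  "normal_module sH Delta eps S R dual_scale (dual_space sM) (dual_act S act) dcoact"
  unfolding normal_module_def
proof (intro conjI allI impI; (unfold mem_dual_space_iff)?)
  show "Vector_Spaces.vector_space (dual_scale :: 'k \<Rightarrow> ('m \<Rightarrow> 'k) \<Rightarrow> _)"
    by (rule vector_space_dual_scale)
  then interpret dual: vector_space "dual_scale :: 'k \<Rightarrow> ('m \<Rightarrow> 'k) \<Rightarrow> _" .
  show "dual.subspace (dual_space sM)"
    by (auto simp: dual.subspace_def mem_dual_space_iff lform_def dual_scale_def algebra_simps)
  fix f f' :: "'m \<Rightarrow> 'k" and c :: 'k and h g :: 'h
  assume f: "lform sM f"
  show "lform sM (dual_act S act h f)"
    by (rule dual_act_lform[OF f])
  show "dual_act S act (h + g) f = dual_act S act h f + dual_act S act g f"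
    "dual_act S act (sH c h) f = dual_scale c (dual_act S act h f)"
    "dual_act S act h (dual_scale c f) = dual_scale c (dual_act S act h f)"
    "dual_act S act (h * g) f = dual_act S act h (dual_act S act g f)"
    "dual_act S act 1 f = f"
    "dual_act S act h (f + f') = dual_act S act h f + dual_act S act h f'"
    using f by (simp_all add: fun_eq_iff dual_act_def dual_scale_def S_add S_scale S_mult S_one act_simps lform_def)
  show "fst ` set (dcoact f) \<subseteq> dual_space sM"
    using dcoact_lform by (force simp: mem_dual_space_iff)
  show "ten2_eq dual_scale sH (dcoact (dual_scale c f)) (map (\<lambda>(a,b). (dual_scale c a, b)) (dcoact f))"
  proof (rule ten2_eqI[OF vector_space_dual_scale vector_space_H])
    fix F :: "('m \<Rightarrow> 'k) \<Rightarrow> 'k" and k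
    assume "lform dual_scale F" "lf k"
    then show "tsum (dcoact (dual_scale c f)) (\<lambda>a b. F a * k b)
        = tsum (map (\<lambda>(a,b). (dual_scale c a, b)) (dcoact f)) (\<lambda>a b. F a * k b)"
      by (simp add: tsum_dcoact tsum_lists case_prod_beta lform_def) (simp add: dual_scale_def ac_simps)
  qed
  show "ten3_eq dual_scale sH sH
        (concat (map (\<lambda>(m0,m1). map (\<lambda>(m00,m01). (m00,m01,m1)) (dcoact m0)) (dcoact f)))
        (concat (map (\<lambda>(m0,m1). map (\<lambda>(c,d). (m0,c,d)) (Delta m1)) (dcoact f)))"
    by (rule dcoact_coassoc[OF f])
  show "sum_list (map (\<lambda>(m0,m1). dual_scale (eps m1) m0) (dcoact f)) = f"
    by (rule dcoact_counit[OF f])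
  show "\<exists>ys. ten2_eq dual_scale sH (dcoact f) ys \<and> (\<forall>p\<in>set ys. lform sM (fst p) \<and> snd p \<in> center)"
    using dcoact_center[OF f] by (simp add: mem_dual_space_iff)
  show "ten2_eq dual_scale sH (dcoact (dual_act S act h f))
        (concat (map (\<lambda>(h1,h2,h3). concat (map (\<lambda>(a,b). concat (map (\<lambda>(a',b').
            map (\<lambda>(m0,m1). (dual_act S act (b * h2 * b') m0, S h1 * S a * h3 * a' * m1)) (dcoact f)) R)) R))
          (Delta2 Delta h)))"
    by (rule dcoact_act[OF f])
  assume f': "lform sM f'"
  show "ten2_eq dual_scale sH (dcoact (f + f')) (dcoact f @ dcoact f')"
  proof (rule ten2_eqI[OF vector_space_dual_scale vector_space_H])
    fix F :: "('m \<Rightarrow> 'k) \<Rightarrow> 'k" and k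
    assume "lform dual_scale F" "lf k"
    then show "tsum (dcoact (f + f')) (\<lambda>a b. F a * k b) = tsum (dcoact f @ dcoact f') (\<lambda>a b. F a * k b)"
      by (simp add: tsum_dcoact tsum_lists lform_def tsum_add algebra_simps)
  qed
qed

end

theorem theorem2p8:
  fixes sH :: "'k::field \<Rightarrow> 'h::ring_1 \<Rightarrow> 'h"
    and Delta :: "'h \<Rightarrow> ('h \<times> 'h) list" and eps :: "'h \<Rightarrow> 'k" and S :: "'h \<Rightarrow> 'h"
    and R :: "('h \<times> 'h) list"
    and sM :: "'k \<Rightarrow> 'm::ab_group_add \<Rightarrow> 'm" and act :: "'h \<Rightarrow> 'm \<Rightarrow> 'm"
    and coact :: "'m \<Rightarrow> ('m \<times> 'h) list"
    and B :: "('m \<times> ('m \<Rightarrow> 'k)) list"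
  assumes "semiquasitriangular sH Delta eps S R"
    and "normal_module sH Delta eps S R sM UNIV act coact"
    and "dual_bases sM UNIV B"
  shows "normal_module sH Delta eps S R dual_scale (dual_space sM) (dual_act S act) (dual_coact S coact B)"
proof -
  interpret normal_hopf_module sH Delta eps S R sM act coact B
    using assms by unfold_locales (simp_all add: semiquasitriangular_def)
  show ?thesis by (rule normal_module_dual)
qed

end
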